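(* Let $q_1$ be a power of $2$, $q=q_1^2$, and let $m$ be odd. Let $n=q^m-1$ and let $\beta$ be a primitive $n$-th root of unity in $\mathbb{F}_{q^m}$. Put $\delta=q_1^m-1$ and assume $\delta\ge 2$. Let $g(x)$ be the generator polynomial of the BCH code $\mathcal{C}_{(q,n,\delta,1,\beta)}$ and $g^{\perp_H}(x)$ the generator polynomial of its Hermitian dual $\mathcal{C}_{(q,n,\delta,1,\beta)}^{\perp_H}$. Let $\mathcal{C}'$ denote the cyclic code of length $2n$ over $\mathbb{F}_q$ with generator polynomial $g(x)g^{\perp_H}(x)$. Then $\mathcal{C}'$ is a Hermitian self-dual cyclic code with parameters $$[2(q^m-1),\;q^m-1,\;2(q_1^m-1)]_q.$$ That is, its minimum distance is exactly $2(q_1^m-1)$.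
   Context: An $[n,k,d]_q$ code is a $k$-dimensional linear subspace of $\mathbb{F}_q^n$ with minimum Hamming distance $d$. For $q=q_1^2$, the Hermitian inner product on $\mathbb{F}_q^n$ is $\langle x,y\rangle_H=\sum_i x_iy_i^{q_1}$, the Hermitian dual is $\mathcal{C}^{\perp_H}=\{c\in\mathbb{F}_q^n:\langle c,y\rangle_H=0\ \forall y\in\mathcal{C}\}$, and $\mathcal{C}$ is Hermitian self-dual if $\mathcal{C}=\mathcal{C}^{\perp_H}$. A cyclic code of length $N$ over $\mathbb{F}_q$ is identified with an ideal of $\mathbb{F}_q[x]/\langle x^N-1\rangle$ via $(c_0,\dots,c_{N-1})\mapsto c_0+c_1x+\dots+c_{N-1}x^{N-1}$; its generator polynomial is the unique monic divisor of $x^N-1$ generating it. For $\gcd(n,q)=1$ and $\beta$ a primitive $n$-th root of unity, $m_{\beta^i}(x)$ denotes the minimal polynomial of $\beta^i$ over $\mathbb{F}_q$. For integers $\delta\ge2$ and $b$, the BCH code $\mathcal{C}_{(q,n,\delta,b,\beta)}$ is the cyclic code of length $n$ over $\mathbb{F}_q$ with generator polynomial $\mathrm{lcm}\{m_{\beta^b}(x),\dots,m_{\beta^{b+\delta-2}}(x)\}$. *)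

theory Defs
  imports "Jordan_Normal_Form.VS_Connect" "HOL-Algebra.QuotRing"
    "HOL-Computational_Algebra.Polynomial_Factorial" "HOL-Library.Cardinality"
begin

(* Words of length N over F are elements of carrier_vec N. *)

definition linear_code :: "nat \<Rightarrow> 'a::field vec set \<Rightarrow> bool" where
  "linear_code N C \<longleftrightarrow> VectorSpace.subspace class_ring C (module_vec TYPE('a) N)"

definition code_dim :: "nat \<Rightarrow> 'a::field vec set \<Rightarrow> nat" where
  "code_dim N C = vectorspace.dim class_ring ((module_vec TYPE('a) N)\<lparr>carrier := C\<rparr>)"

definition hamming_dist :: "'a vec \<Rightarrow> 'a vec \<Rightarrow> nat" where
  "hamming_dist u v = card {i. i < dim_vec u \<and> u $ i \<noteq> v $ i}"

(* A relation rather than a function: a code with at most one word has no minimum distance. *)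
definition is_min_distance :: "'a vec set \<Rightarrow> nat \<Rightarrow> bool" where
  "is_min_distance C d \<longleftrightarrow>
     (\<exists>x\<in>C. \<exists>y\<in>C. x \<noteq> y \<and> hamming_dist x y = d) \<and>
     (\<forall>x\<in>C. \<forall>y\<in>C. x \<noteq> y \<longrightarrow> d \<le> hamming_dist x y)"

definition has_parameters :: "'a::field vec set \<Rightarrow> nat \<Rightarrow> nat \<Rightarrow> nat \<Rightarrow> bool" where
  "has_parameters C N k d \<longleftrightarrow> linear_code N C \<and> code_dim N C = k \<and> is_min_distance C d"

(* The parameter r is the exponent of the conjugation x \<mapsto> x^r, so the field has r^2 elements. *)

definition hermitian_inner :: "nat \<Rightarrow> 'a::field vec \<Rightarrow> 'a vec \<Rightarrow> 'a" where
  "hermitian_inner r x y = (\<Sum>i<dim_vec x. x $ i * (y $ i) ^ r)"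

definition hermitian_dual :: "nat \<Rightarrow> nat \<Rightarrow> 'a::field vec set \<Rightarrow> 'a vec set" where
  "hermitian_dual r N C = {c \<in> carrier_vec N. \<forall>y\<in>C. hermitian_inner r c y = 0}"

definition hermitian_self_dual :: "nat \<Rightarrow> nat \<Rightarrow> 'a::field vec set \<Rightarrow> bool" where
  "hermitian_self_dual r N C \<longleftrightarrow> C = hermitian_dual r N C"

definition poly_of_word :: "'a::comm_monoid_add vec \<Rightarrow> 'a poly" where
  "poly_of_word v = (\<Sum>i<dim_vec v. monom (v $ i) i)"

(* F[x] / (x^N - 1), with F[x] seen as an explicit ring via class_ring. *)
definition cyclic_ring :: "nat \<Rightarrow> 'a::field poly set ring" where
  "cyclic_ring N = class_ring Quot (PIdl\<^bsub>class_ring\<^esub> (monom 1 N - 1))"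

definition residue_class :: "nat \<Rightarrow> 'a::field poly \<Rightarrow> 'a poly set" where
  "residue_class N p = PIdl\<^bsub>class_ring\<^esub> (monom 1 N - 1) +>\<^bsub>class_ring\<^esub> p"

definition code_residues :: "nat \<Rightarrow> 'a::field vec set \<Rightarrow> 'a poly set set" where
  "code_residues N C = (\<lambda>v. residue_class N (poly_of_word v)) ` C"

definition cyclic_code :: "nat \<Rightarrow> 'a::field vec set \<Rightarrow> bool" where
  "cyclic_code N C \<longleftrightarrow> linear_code N C \<and> ideal (code_residues N C) (cyclic_ring N)"

definition is_generator_poly :: "nat \<Rightarrow> 'a::field vec set \<Rightarrow> 'a poly \<Rightarrow> bool" where
  "is_generator_poly N C g \<longleftrightarrow>
     cyclic_code N C \<and> lead_coeff g = 1 \<and> g dvd monom 1 N - 1 \<and>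
     code_residues N C = PIdl\<^bsub>cyclic_ring N\<^esub> (residue_class N g)"

definition generator_poly :: "nat \<Rightarrow> 'a::field vec set \<Rightarrow> 'a poly" where
  "generator_poly N C = (THE g. is_generator_poly N C g)"

definition code_generated_by :: "nat \<Rightarrow> 'a::field poly \<Rightarrow> 'a vec set" where
  "code_generated_by N g =
     {v \<in> carrier_vec N.
        residue_class N (poly_of_word v) \<in> PIdl\<^bsub>cyclic_ring N\<^esub> (residue_class N g)}"

definition primitive_root_of_unity :: "nat \<Rightarrow> 'b::field \<Rightarrow> bool" where
  "primitive_root_of_unity n \<beta> \<longleftrightarrow>
     0 < n \<and> \<beta> ^ n = 1 \<and> (\<forall>k. 0 < k \<and> k < n \<longrightarrow> \<beta> ^ k \<noteq> 1)"

(* The extension field 'b is given over the base field 'a by an embedding h; minimal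
   polynomials have coefficients in 'a. *)
definition is_minimal_poly :: "('a::field \<Rightarrow> 'b::field) \<Rightarrow> 'b \<Rightarrow> 'a poly \<Rightarrow> bool" where
  "is_minimal_poly h \<gamma> p \<longleftrightarrow>
     lead_coeff p = 1 \<and> poly (map_poly h p) \<gamma> = 0 \<and>
     (\<forall>r. r \<noteq> 0 \<and> poly (map_poly h r) \<gamma> = 0 \<longrightarrow> degree p \<le> degree r)"

definition minimal_poly :: "('a::field \<Rightarrow> 'b::field) \<Rightarrow> 'b \<Rightarrow> 'a poly" where
  "minimal_poly h \<gamma> = (THE p. is_minimal_poly h \<gamma> p)"

(* Lcm on polynomials over a field is normalized to be monic; the sort field_gcd only provides
   the canonical gcd and lcm operations and excludes no field. *)
definition bch_code ::
  "('a::field_gcd \<Rightarrow> 'b::field) \<Rightarrow> nat \<Rightarrow> nat \<Rightarrow> int \<Rightarrow> 'b \<Rightarrow> 'a vec set" where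
  "bch_code h n \<delta> b \<beta> =
     code_generated_by n (Lcm ((\<lambda>i. minimal_poly h (\<beta> powi i)) ` {b..b + int \<delta> - 2}))"

end

theory Submission
  imports Defs "Jordan_Normal_Form.Char_Poly"
begin

text \<open>
  Write $Q = r^m$, where $r$ is the paper's $q_1$, so that $n = Q^2 - 1$, and let $f = (x^n - 1)/g$.
  The Hermitian dual of the code generated by $g$ is generated by the monic conjugate-reciprocal
  $f^\dagger$. The map $\dagger$ is multiplicative, fixes $x^n - 1$ and is an involution on the
  divisors of $x^n - 1$. In characteristic $2$ we have $x^{2n} - 1 = (x^n - 1)^2$, hence
  $(x^{2n} - 1)/(g f^\dagger) = f g^\dagger$, whose image under $\dagger$ is $g f^\dagger$ again: this is
  self-duality.

  For the distance, an estimate on exponents modulo $Q^2 - 1$ shows that $f^\dagger$ vanishes at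
  $\beta^k$ for all $k \le 2Q - 2$. For a codeword $c$ of length $2n$, adding the entries at $j$ and
  $j + n$ gives a word $d$ with these zeros. If $d \neq 0$, the BCH bound gives weight at least $2Q$.
  If $d = 0$, then $c$ has as many nonzero entries at even as at odd positions, since $n$ is odd. The
  elements $\beta^k$ with $1 \le k < \delta$ are common roots of $g$ and $f^\dagger$, so they are double
  roots of $c$, and the derivative isolates the odd part, which thus has weight at least $\delta$.
  The bound $2\delta$ is attained by $(x^{2n} - 1)/(x^{Q+1} - 1)$.
\<close>

subsection \<open>Cyclic codes as divisibility conditions\<close>

lemma PIdl_class_ring:
  "PIdl\<^bsub>class_ring\<^esub> (a :: 'a::comm_ring_1) = {x. a dvd x}"
  by (auto simp: cgenideal_def dvd_def mult.commute)

lemma residue_class_eq: "residue_class N p = {x. monom 1 N - 1 dvd x - p}"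
proof (rule Set.set_eqI, rule iffI)
  fix x assume "x \<in> residue_class N p"
  then show "x \<in> {x. monom 1 N - 1 dvd x - p}"
    by (auto simp: residue_class_def PIdl_class_ring a_r_coset_def r_coset_def)
next
  fix x assume "x \<in> {x. monom 1 N - 1 dvd x - p}"
  then show "x \<in> residue_class N p"
    by (auto simp: residue_class_def PIdl_class_ring a_r_coset_def r_coset_def
        intro!: exI[of _ "x - p"])
qed

lemma residue_class_eq_iff:
  "residue_class N p = residue_class N p' \<longleftrightarrow> monom 1 N - 1 dvd p - p'"
proof
  assume "residue_class N p = residue_class N p'"
  moreover have "p \<in> residue_class N p" by (simp add: residue_class_eq)
  ultimately show "monom 1 N - 1 dvd p - p'" by (simp add: residue_class_eq)
next
  assume *: "monom 1 N - 1 dvd p - p'"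
  have "monom 1 N - 1 dvd x - p \<longleftrightarrow> monom 1 N - 1 dvd x - p'" for x
    using dvd_add[OF _ *, of "x - p"] dvd_diff[OF _ *, of "x - p'"] by auto
  then show "residue_class N p = residue_class N p'"
    by (simp add: residue_class_eq)
qed

lemma cyclic_ideal: "ideal (PIdl\<^bsub>class_ring\<^esub> (p :: 'a::field poly)) class_ring"
  by (rule cring.cgenideal_ideal) (auto intro: class_cring.cring_axioms)

lemma cyclic_ring_cring: "cring (cyclic_ring N :: 'a::field poly set ring)"
  unfolding cyclic_ring_def
  by (rule ideal.quotient_is_cring[OF cyclic_ideal]) (rule class_cring.cring_axioms)

lemma residue_class_ring_hom: "residue_class N \<in> Ring.ring_hom class_ring (cyclic_ring N)"
  unfolding cyclic_ring_def residue_class_def using ideal.rcos_ring_hom[OF cyclic_ideal] .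

lemma carrier_cyclic_ring: "carrier (cyclic_ring N) = range (residue_class N)"
  by (auto simp: cyclic_ring_def FactRing_def A_RCOSETS_def RCOSETS_def residue_class_def
      a_r_coset_def)

lemma residue_class_mult:
  "residue_class N p \<otimes>\<^bsub>cyclic_ring N\<^esub> residue_class N p' = residue_class N (p * p')"
  using ring_hom_mult[OF residue_class_ring_hom, of p p' N] by simp

lemma PIdl_cyclic_ring:
  "PIdl\<^bsub>cyclic_ring N\<^esub> (residue_class N g) = range (\<lambda>a. residue_class N (a * g))"
  by (auto simp: cgenideal_def carrier_cyclic_ring image_iff residue_class_mult)
    (metis residue_class_mult)

text \<open>Since \<open>g\<close> divides x^N - 1, divisibility by \<open>g\<close> depends only on
  the residue class. From here on, ideals of the quotient ring are replaced by divisibility in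
  F[x].\<close>

lemma residue_class_mem_PIdl:
  assumes "g dvd monom 1 N - 1"
  shows "residue_class N p \<in> PIdl\<^bsub>cyclic_ring N\<^esub> (residue_class N g) \<longleftrightarrow> g dvd p"
proof
  assume "residue_class N p \<in> PIdl\<^bsub>cyclic_ring N\<^esub> (residue_class N g)"
  then obtain a where "monom 1 N - 1 dvd p - a * g"
    by (auto simp: PIdl_cyclic_ring residue_class_eq_iff)
  then have "g dvd p - a * g" using assms dvd_trans by blast
  then have "g dvd (p - a * g) + a * g" by (intro dvd_add) auto
  then show "g dvd p" by simp
next
  assume "g dvd p"
  then show "residue_class N p \<in> PIdl\<^bsub>cyclic_ring N\<^esub> (residue_class N g)"
    by (auto simp: PIdl_cyclic_ring dvd_def mult.commute)
qed

section \<open>Words as polynomials of degree below \<open>N\<close>\<close>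

lemma coeff_poly_of_word: "coeff (poly_of_word v) i = (if i < dim_vec v then v $ i else 0)"
  by (simp add: poly_of_word_def coeff_sum if_distrib[of "\<lambda>x. x = _"])

lemma degree_poly_of_word: "0 < dim_vec v \<Longrightarrow> degree (poly_of_word v) < dim_vec v"
  by (rule degree_lessI) (auto simp: coeff_poly_of_word)

lemma poly_of_word_vec: "degree p < N \<Longrightarrow> poly_of_word (vec N (coeff p)) = p"
  by (rule poly_eqI) (simp add: coeff_poly_of_word coeff_eq_0)

lemma poly_of_word_inject:
  assumes "dim_vec u = dim_vec v" "poly_of_word u = poly_of_word v"
  shows "u = v"
proof (rule eq_vecI)
  fix i assume "i < dim_vec v"
  then show "u $ i = v $ i"
    using arg_cong[OF assms(2), of "\<lambda>p. coeff p i"] assms(1) by (simp add: coeff_poly_of_word)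
qed (fact assms)

lemma poly_of_word_add:
  "dim_vec u = dim_vec v \<Longrightarrow> poly_of_word (u + v) = poly_of_word u + poly_of_word v"
  by (rule poly_eqI) (simp add: coeff_poly_of_word)

lemma poly_of_word_smult: "poly_of_word (a \<cdot>\<^sub>v v) = Polynomial.smult a (poly_of_word v)"
  by (rule poly_eqI) (simp add: coeff_poly_of_word)

lemma poly_of_word_zero [simp]: "poly_of_word (0\<^sub>v N) = 0"
  by (rule poly_eqI) (simp add: coeff_poly_of_word)

lemma degree_monom_minus_1 [simp]: "degree (monom 1 N - 1 :: 'a::field poly) = N"
proof (cases "N = 0")
  case False
  have "degree (monom 1 N + (- 1) :: 'a poly) = degree (monom 1 N :: 'a poly)"
    by (rule degree_add_eq_left) (use False in \<open>simp add: degree_monom_eq\<close>)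
  then show ?thesis by (simp add: degree_monom_eq)
qed simp

lemma monom_minus_1_neq_0: "0 < N \<Longrightarrow> monom 1 N - 1 \<noteq> (0 :: 'a::field poly)"
  by (metis degree_0 degree_monom_minus_1 less_numeral_extra(3))

lemma lead_coeff_monom_minus_1:
  "0 < N \<Longrightarrow> lead_coeff (monom 1 N - 1 :: 'a::field poly) = 1"
  by (simp add: coeff_pCons split: nat.splits)

lemma code_generated_by_eq:
  assumes "g dvd monom 1 N - 1"
  shows "code_generated_by N g = {v \<in> carrier_vec N. g dvd poly_of_word v}"
  by (simp add: code_generated_by_def residue_class_mem_PIdl[OF assms])

lemma linear_code_dvd:
  "linear_code N {v \<in> carrier_vec N. (g :: 'a::field poly) dvd poly_of_word v}" 
  unfolding linear_code_def VectorSpace.subspace_def submodule_def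
  by (auto simp: vec_vs vec_module module_vec_simps poly_of_word_add poly_of_word_smult
      intro: dvd_smult)

lemma code_residues_code_generated_by:
  assumes "0 < N" "g dvd monom 1 N - 1"
  shows "code_residues N (code_generated_by N g) = PIdl\<^bsub>cyclic_ring N\<^esub> (residue_class N g)"
proof
  show "code_residues N (code_generated_by N g) \<subseteq> PIdl\<^bsub>cyclic_ring N\<^esub> (residue_class N g)"
    by (auto simp: code_residues_def code_generated_by_def)
  show "PIdl\<^bsub>cyclic_ring N\<^esub> (residue_class N g) \<subseteq> code_residues N (code_generated_by N g)"
  proof
    fix x assume x: "x \<in> PIdl\<^bsub>cyclic_ring N\<^esub> (residue_class N g)"
    then obtain a where a: "x = residue_class N a" by (auto simp: PIdl_cyclic_ring)
    \<comment> \<open>The remainder is the representative of degree below \<open>N\<close>, so it is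
      the polynomial of a word.\<close>
    define p where "p = a mod (monom 1 N - 1)"
    have "degree p < N"
      unfolding p_def using degree_mod_less'[of "monom 1 N - 1" a] monom_minus_1_neq_0[OF assms(1)]
      assms(1)
      by (cases "a mod (monom 1 N - 1) = 0") auto
    then have p: "poly_of_word (vec N (coeff p)) = p" by (rule poly_of_word_vec)
    have "x = residue_class N p"
      by (auto simp: a residue_class_eq_iff p_def minus_mod_eq_mult_div)
    with x p show "x \<in> code_residues N (code_generated_by N g)"
      by (auto simp: code_residues_def code_generated_by_def intro!: image_eqI[of _ _ "vec N (coeff p)"])
  qed
qed

lemma is_generator_poly_code_generated_by:
  assumes "0 < N" "g dvd monom 1 N - 1" "lead_coeff g = 1"
  shows "is_generator_poly N (code_generated_by N g) g"
  using assms code_residues_code_generated_by[OF assms(1,2)]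
    linear_code_dvd[of N g] cring.cgenideal_ideal[OF cyclic_ring_cring, of "residue_class N g" N]
  by (auto simp: is_generator_poly_def cyclic_code_def code_generated_by_eq carrier_cyclic_ring)

text \<open>\<open>is_generator_poly\<close> speaks only about the set of residues. The words are
  recovered because two polynomials of degree below \<open>N\<close> that agree modulo x^N - 1 are
  equal.\<close>

lemma is_generator_poly_imp_code:
  assumes "0 < N" "is_generator_poly N D g"
  shows "D = {v \<in> carrier_vec N. g dvd poly_of_word v}"
proof -
  from assms(2) have dvd: "g dvd monom 1 N - 1"
    and eq: "code_residues N D = PIdl\<^bsub>cyclic_ring N\<^esub> (residue_class N g)"
    and lin: "linear_code N D"
    by (auto simp: is_generator_poly_def cyclic_code_def)
  have D: "D \<subseteq> carrier_vec N"
    using lin by (auto simp: linear_code_def VectorSpace.subspace_def submodule_def module_vec_def)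
  have "v \<in> D" if v: "v \<in> carrier_vec N" "g dvd poly_of_word v" for v
  proof -
    have "residue_class N (poly_of_word v) \<in> code_residues N D"
      using v by (simp add: eq residue_class_mem_PIdl[OF dvd])
    then obtain w where w: "w \<in> D" "monom 1 N - 1 dvd poly_of_word v - poly_of_word w"
      by (auto simp: code_residues_def residue_class_eq_iff)
    have "degree (poly_of_word v - poly_of_word w) < N"
      using w(1) v(1) D assms(1) by (intro degree_lessI) (auto simp: coeff_poly_of_word)
    then have "poly_of_word v = poly_of_word w"
      using w(2) dvd_imp_degree_le[OF w(2)] by force
    then have "v = w" using v(1) w(1) D by (intro poly_of_word_inject) auto
    with w(1) show ?thesis by simp
  qed
  moreover have "g dvd poly_of_word v" if "v \<in> D" for v
    using that eq by (force simp: code_residues_def residue_class_mem_PIdl[OF dvd, symmetric])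
  ultimately show ?thesis using D by auto
qed

text \<open>The word with the coefficients of \<open>g\<close> tests the inclusion. A
  \<open>g\<close> of degree \<open>N\<close> does not fit into a word, but then it is an associate
  of x^N - 1 and hence a multiple of \<open>g'\<close>.\<close>

lemma dvd_generator_if_code_subset:
  assumes N: "0 < N" and dvd: "g dvd monom 1 N - 1" "g' dvd monom 1 N - 1"
    and eq: "{v \<in> carrier_vec N. g dvd poly_of_word v} \<subseteq> {v \<in> carrier_vec N. g' dvd poly_of_word v}"
  shows "g' dvd (g :: 'a::field poly)"
proof (cases "degree g < N")
  case True
  then have "g dvd poly_of_word (vec N (coeff g))" by (simp add: poly_of_word_vec)
  then have "g' dvd poly_of_word (vec N (coeff g))" using eq by force
  then show ?thesis using True by (simp add: poly_of_word_vec)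
next
  case False
  obtain a where a: "monom 1 N - 1 = g * a" using dvd(1) by blast
  then have nz: "g \<noteq> 0" "a \<noteq> 0" using monom_minus_1_neq_0[OF N] by auto
  have "N = degree g + degree a" using degree_mult_eq[OF nz] a degree_monom_minus_1 by metis
  then have "degree a = 0" using False by simp
  then have "is_unit a" using nz by (simp add: is_unit_iff_degree)
  then have "monom 1 N - 1 dvd g" unfolding a by (simp add: mult_unit_dvd_iff)
  with dvd(2) show ?thesis by (rule dvd_trans)
qed

text \<open>Justifies the definite description in \<open>generator_poly\<close>: both polynomials
  define the same words, so they divide each other, and both are monic.\<close>

lemma is_generator_poly_unique:
  fixes g g' :: "'a::field poly"
  assumes "0 < N" "is_generator_poly N D g" "is_generator_poly N D g'"
  shows "g = g'"
proof -
  have gg: "g dvd monom 1 N - 1" "g' dvd monom 1 N - 1"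
    using assms by (auto simp: is_generator_poly_def)
  have "{v \<in> carrier_vec N. g dvd poly_of_word v} = {v \<in> carrier_vec N. g' dvd poly_of_word v}"
    using is_generator_poly_imp_code[OF assms(1,2)] is_generator_poly_imp_code[OF assms(1,3)]
    by simp
  then have "g dvd g'" "g' dvd g"
    using dvd_generator_if_code_subset[OF assms(1) gg] dvd_generator_if_code_subset[OF assms(1) gg(2,1)]
    by simp_all
  then show ?thesis
    using assms(2,3) by (intro poly_dvd_antisym) (auto simp: is_generator_poly_def)
qed

lemma generator_poly_code_generated_by:
  assumes "0 < N" "g dvd monom 1 N - 1" "lead_coeff g = 1"
  shows "generator_poly N (code_generated_by N g) = g"
  unfolding generator_poly_def
  using is_generator_poly_code_generated_by[OF assms] is_generator_poly_unique[OF assms(1)]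
  by blast

text \<open>Multiplication by \<open>g\<close> is a linear isomorphism from all words of length
  \<open>N - degree g\<close> onto the code.\<close>

lemma code_dim_dvd:
  fixes g :: "'a::field poly"
  assumes "0 < N" "g \<noteq> 0" "degree g \<le> N"
  shows "code_dim N {v \<in> carrier_vec N. g dvd poly_of_word v} = N - degree g"
proof -
  define D where "D = {v \<in> carrier_vec N. g dvd poly_of_word v}"
  define k where "k = N - degree g"
  define T where "T v = vec N (coeff (poly_of_word v * g))" for v
  let ?K = "class_ring :: 'a ring" and ?V = "module_vec TYPE('a) k"
    and ?W = "(module_vec TYPE('a) N)\<lparr>carrier := D\<rparr>"
  have deg: "degree (poly_of_word v * g) < N" if "v \<in> carrier_vec k" for v
  proof (cases "poly_of_word v = 0")
    case False
    then have "0 < k" using that by (cases "k = 0") (auto simp: poly_eq_iff coeff_poly_of_word)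
    then show ?thesis
      using degree_mult_le[of "poly_of_word v" g] degree_poly_of_word[of v] that by (auto simp: k_def)
  qed (use assms(1) in auto)
  have pT: "poly_of_word (T v) = poly_of_word v * g" if "v \<in> carrier_vec k" for v
    unfolding T_def by (rule poly_of_word_vec[OF deg[OF that]])
  have T_dim [simp]: "dim_vec (T v) = N" "T v \<in> carrier_vec N" for v by (simp_all add: T_def)
  have sub: "VectorSpace.subspace ?K D (module_vec TYPE('a) N)"
    using linear_code_dvd[of N g] by (simp add: linear_code_def D_def)
  have W: "vectorspace ?K ?W"
    using vectorspace.subspace_is_vs[OF vec_vs sub] .
  have T_add: "T (u + v) = T u + T v" if "u \<in> carrier_vec k" "v \<in> carrier_vec k" for u v
    by (rule poly_of_word_inject) (use that in \<open>auto simp: pT poly_of_word_add algebra_simps\<close>)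
  have T_smult: "T (a \<cdot>\<^sub>v v) = a \<cdot>\<^sub>v T v" if "v \<in> carrier_vec k" for a v
    by (rule poly_of_word_inject) (use that in \<open>auto simp: pT poly_of_word_smult\<close>)
  have lm: "linear_map ?K ?V ?W T"
    unfolding linear_map_def mod_hom_def mod_hom_axioms_def LinearCombinations.module_hom_def
    using W vec_vs[of k] vectorspace.axioms(1)[OF W] vec_module[of k]
    by (auto simp: module_vec_simps T_add T_smult D_def pT)
  have "inj_on T (carrier ?V)"
  proof (rule inj_onI)
    fix u v assume uv: "u \<in> carrier ?V" "v \<in> carrier ?V" "T u = T v"
    then have "poly_of_word u * g = poly_of_word v * g"
      using pT by (metis module_vec_simps(3))
    then show "u = v" using uv assms(2)
      by (intro poly_of_word_inject) (auto simp: module_vec_simps)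
  qed
  moreover have "T ` carrier ?V = carrier ?W"
  proof
    show "T ` carrier ?V \<subseteq> carrier ?W" by (auto simp: module_vec_simps D_def pT)
    show "carrier ?W \<subseteq> T ` carrier ?V"
    proof
      fix w assume "w \<in> carrier ?W"
      then have w: "w \<in> carrier_vec N" "g dvd poly_of_word w" by (auto simp: D_def)
      then obtain a where a: "poly_of_word w = a * g" by (auto simp: dvd_def mult.commute)
      have "T (vec k (coeff a)) = w"
      proof (cases "a = 0")
        case True
        then show ?thesis using w a
          by (intro poly_of_word_inject) (auto simp: pT poly_eq_iff[of "poly_of_word (vec k _)"] coeff_poly_of_word)
      next
        case False
        then have "degree a + degree g < N"
          using degree_poly_of_word[of w] w(1) assms a by (simp add: degree_mult_eq)
        then have "poly_of_word (vec k (coeff a)) = a" by (intro poly_of_word_vec) (simp add: k_def)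
        then show ?thesis using w a by (intro poly_of_word_inject) (auto simp: pT)
      qed
      then show "w \<in> T ` carrier ?V" by (auto simp: module_vec_simps intro!: image_eqI[of _ _ "vec k (coeff a)"])
    qed
  qed
  ultimately have "vectorspace.dim ?K ?V = vectorspace.dim ?K ?W"
    by (intro linear_map.dim_eq[OF lm] vec_space.fin_dim)
  then show ?thesis by (simp add: code_dim_def D_def k_def vec_space.dim_is_n)
qed

text \<open>The word is the geometric sum 1 + x^L + x^(2L) + ... with \<open>M div L\<close> terms,
  so the product telescopes.\<close>

lemma monom_minus_1_mult_comb:
  assumes "L dvd M" "0 < L"
  shows "(monom 1 L - 1) * poly_of_word (vec M (\<lambda>i. of_bool (L dvd i))) = (monom 1 M - 1 :: 'a::field poly)"
proof (rule poly_eqI)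
  fix i
  obtain K where K: "M = L * K" using assms(1) by blast
  show "coeff ((monom 1 L - 1) * poly_of_word (vec M (\<lambda>i. of_bool (L dvd i)))) i
    = coeff (monom 1 M - 1 :: 'a poly) i"
  proof (cases "L dvd i")
    case True
    then obtain j where j: "i = L * j" by blast
    have "L * j - L = L * (j - 1)" by (simp add: diff_mult_distrib2)
    then show ?thesis
      using assms(2) by (auto simp: left_diff_distrib coeff_monom_mult coeff_poly_of_word K j)
  next
    case False
    then have "L dvd i - L \<Longrightarrow> i < L"
      by (metis dvd_diffD dvd_refl not_less)
    then show ?thesis
      using False by (auto simp: left_diff_distrib coeff_monom_mult coeff_poly_of_word K)
  qed
qed

subsection \<open>Hermitian duals of cyclic codes\<close>

text \<open>
  If $f \nmid R$, take $b = R \bmod f$: the multiple $x^e g$ for which $x^e b g$ has degree exactly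
  $N - 1$ detects the leading coefficient of $b$.
\<close>

lemma dvd_iff_coeffs_vanish:
  fixes f g R :: "'a::field poly"
  assumes N: "0 < N" and fg: "f * g = monom 1 N - 1" and R: "degree R < N"
  shows "f dvd R \<longleftrightarrow> (\<forall>y\<in>carrier_vec N. g dvd poly_of_word y \<longrightarrow> coeff (R * poly_of_word y) (N - 1) = 0)"
proof -
  have nz: "f \<noteq> 0" "g \<noteq> 0" using fg monom_minus_1_neq_0[OF N] by auto
  have deg: "degree f + degree g = N"
    using degree_mult_eq[OF nz] by (simp add: fg)
  \<comment> \<open>The product is (x^N - 1) w and has degree at most 2N - 2, so \<open>w\<close> is
    zero or has degree at most N - 2. The coefficient at N - 1 is minus that of \<open>w\<close>,
    hence zero.\<close>
  have vanish: "coeff (P * y) (N - 1) = 0"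
    if "f dvd P" "degree P < N" "g dvd y" "degree y < N" for P y
  proof -
    have "f * g dvd P * y" using that by (intro mult_dvd_mono)
    then obtain w where w: "P * y = (monom 1 N - 1) * w" unfolding fg by (rule dvdE)
    have "coeff w (N - 1) = 0"
    proof (cases "w = 0")
      case False
      have "N + degree w = degree (P * y)"
        unfolding w using degree_mult_eq[OF monom_minus_1_neq_0[OF N] False] by simp
      also have "\<dots> \<le> degree P + degree y" by (rule degree_mult_le)
      finally show ?thesis using that by (intro coeff_eq_0) simp
    qed simp
    then show ?thesis unfolding w using N by (simp add: left_diff_distrib coeff_monom_mult)
  qed
  show ?thesis
  proof
    assume "f dvd R"
    then show "\<forall>y\<in>carrier_vec N. g dvd poly_of_word y \<longrightarrow> coeff (R * poly_of_word y) (N - 1) = 0"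
      using vanish R N degree_poly_of_word by (metis carrier_vecD)
  next
    assume *: "\<forall>y\<in>carrier_vec N. g dvd poly_of_word y \<longrightarrow> coeff (R * poly_of_word y) (N - 1) = 0"
    define b where "b = R mod f"
    have "b = 0"
    proof (rule ccontr)
      assume b: "b \<noteq> 0"
      then have db: "degree b < degree f"
        unfolding b_def using degree_mod_less'[OF nz(1)] by blast
      define e where "e = N - 1 - degree b - degree g"
      have e: "e + degree g + degree b = N - 1" using db deg by (simp add: e_def)
      define y where "y = monom 1 e * g"
      have dy: "degree y = e + degree g"
        using nz by (simp add: y_def degree_mult_eq degree_monom_eq)
      then have "degree y < N" using e N by simp
      then have "coeff (R * y) (N - 1) = 0"
        using *[rule_format, of "vec N (coeff y)"] by (simp add: poly_of_word_vec y_def)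
      \<comment> \<open>\<open>R - b\<close> is a multiple of \<open>f\<close>, so by
        \<open>vanish\<close> only \<open>b\<close> contributes to the coefficient.\<close>
      moreover have "coeff ((R - b) * y) (N - 1) = 0"
      proof (rule vanish)
        show "f dvd R - b" by (simp add: b_def minus_mod_eq_mult_div)
        show "degree (R - b) < N" using R db deg by (intro degree_diff_less) auto
      qed (use \<open>degree y < N\<close> in \<open>auto simp: y_def\<close>)
      ultimately have "coeff (b * y) (N - 1) = 0" by (simp add: left_diff_distrib)
      moreover have "degree (b * y) = N - 1" "b * y \<noteq> 0"
        using b e dy nz by (auto simp: degree_mult_eq y_def)
      ultimately show False by (metis leading_coeff_0_iff)
    qed
    then show "f dvd R" by (simp add: b_def mod_eq_0_iff_dvd)
  qed
qed

text \<open>Abstracts x \<mapsto> x^r on the field with r^2 elements to an involutive field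
  homomorphism.\<close>

locale conjugation = field_hom conj for conj :: "'a::field_gcd \<Rightarrow> 'a" +
  fixes r :: nat
  assumes conj_eq: "conj x = x ^ r" and conj_conj [simp]: "conj (conj x) = x"
begin

sublocale map_poly_conj: map_poly_inj_idom_hom conj ..

text \<open>This is x^(deg f) F(1/x), where F is \<open>f\<close> with conjugated
  coefficients.\<close>

definition rev_conj :: "'a poly \<Rightarrow> 'a poly" where
  "rev_conj f = reflect_poly (map_poly conj f)"

definition dagger :: "'a poly \<Rightarrow> 'a poly" where
  "dagger f = normalize (rev_conj f)"

lemma rev_conj_mult: "rev_conj (f * g) = rev_conj f * rev_conj g"
  by (simp add: rev_conj_def hom_distribs reflect_poly_mult)

lemma rev_conj_dvd: "f dvd g \<Longrightarrow> rev_conj f dvd rev_conj g"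
  by (auto simp: dvd_def rev_conj_mult)

lemma map_poly_conj_reflect: "map_poly conj (reflect_poly f) = reflect_poly (map_poly conj f)"
  by (rule poly_eqI) (simp add: coeff_reflect_poly)

lemma map_poly_conj_conj [simp]: "map_poly conj (map_poly conj f) = f"
  by (rule poly_eqI) simp

text \<open>In general \<open>reflect_poly\<close> loses the powers of $x$ dividing $f$.\<close>

lemma rev_conj_rev_conj: "coeff f 0 \<noteq> 0 \<Longrightarrow> rev_conj (rev_conj f) = f"
  by (simp add: rev_conj_def map_poly_conj_reflect)

lemma degree_rev_conj: "coeff f 0 \<noteq> 0 \<Longrightarrow> degree (rev_conj f) = degree f"
  by (simp add: rev_conj_def)

lemma dagger_dvd_iff: "dagger f dvd p \<longleftrightarrow> rev_conj f dvd p"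
  by (simp add: dagger_def)

text \<open>Conjugating the inner product moves the exponent \<open>r\<close> from \<open>y\<close>
  to \<open>c\<close>. Reversing \<open>c\<close> then turns the sum into a convolution, that is, a
  coefficient of a product.\<close>

lemma hermitian_inner_eq_coeff:
  assumes "0 < N" "c \<in> carrier_vec N" "y \<in> carrier_vec N"
  shows "conj (hermitian_inner r c y)
    = coeff (poly_of_word (vec N (\<lambda>i. conj (c $ (N - 1 - i)))) * poly_of_word y) (N - 1)"
proof -
  have "conj (hermitian_inner r c y) = (\<Sum>i<N. conj (c $ i) * y $ i)"
    using assms by (simp add: hermitian_inner_def hom_distribs flip: conj_eq)
  also have "\<dots> = (\<Sum>i\<le>N - 1. conj (c $ (N - 1 - i)) * y $ (N - 1 - i))"
    using assms(1) by (intro sum.reindex_bij_witness[of _ "\<lambda>i. N - 1 - i" "\<lambda>i. N - 1 - i"]) auto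
  also have "\<dots> = coeff (poly_of_word (vec N (\<lambda>i. conj (c $ (N - 1 - i)))) * poly_of_word y) (N - 1)"
    unfolding coeff_mult using assms by (intro sum.cong) (auto simp: coeff_poly_of_word)
  finally show ?thesis .
qed

text \<open>Reversal over all \<open>N\<close> positions and \<open>reflect_poly\<close>, which
  reverses only up to the degree, differ by a power of x.\<close>

lemma reversed_word:
  assumes "0 < N" "c \<in> carrier_vec N"
  shows "poly_of_word (vec N (\<lambda>i. conj (c $ (N - 1 - i))))
    = monom 1 (N - 1 - degree (poly_of_word c)) * rev_conj (poly_of_word c)"
proof (rule poly_eqI)
  fix i
  have "degree (poly_of_word c) < N" using assms degree_poly_of_word[of c] by auto
  then show "coeff (poly_of_word (vec N (\<lambda>i. conj (c $ (N - 1 - i))))) i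
    = coeff (monom 1 (N - 1 - degree (poly_of_word c)) * rev_conj (poly_of_word c)) i"
    using assms coeff_eq_0[of "poly_of_word c" "N - 1 - i"]
    by (auto simp: coeff_monom_mult rev_conj_def coeff_reflect_poly coeff_poly_of_word)
qed

lemma coprime_monom: "coeff f 0 \<noteq> 0 \<Longrightarrow> coprime (f :: 'a poly) (monom 1 k)"
proof -
  assume "coeff f 0 \<noteq> 0"
  then have "coprime f [:0, 1:]"
    by (metis coprime_commute dvd_iff_poly_eq_0 field_poly_irreducible_imp_prime
        irreducible_linear_field_poly minus_zero poly_0_coeff_0 prime_elem_imp_coprime zero_neq_one)
  then show ?thesis by (simp add: monom_altdef)
qed

text \<open>A nonzero constant term makes \<open>f\<close> coprime to the power of x in
  \<open>reversed_word\<close>. What remains is to move \<open>rev_conj\<close> across a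
  divisibility.\<close>

lemma dvd_reversed_word_iff:
  assumes "0 < N" "c \<in> carrier_vec N" "coeff f 0 \<noteq> 0"
  shows "f dvd poly_of_word (vec N (\<lambda>i. conj (c $ (N - 1 - i)))) \<longleftrightarrow> rev_conj f dvd poly_of_word c"
proof -
  define p where "p = poly_of_word c"
  have "f dvd poly_of_word (vec N (\<lambda>i. conj (c $ (N - 1 - i)))) \<longleftrightarrow> f dvd rev_conj p"
    unfolding reversed_word[OF assms(1,2)] p_def
    using coprime_dvd_mult_right_iff coprime_monom[OF assms(3)] by blast
  also have "\<dots> \<longleftrightarrow> rev_conj f dvd p"
  proof
    assume "rev_conj f dvd p"
    then have "rev_conj (rev_conj f) dvd rev_conj p" by (auto simp: dvd_def rev_conj_mult)
    then show "f dvd rev_conj p" by (simp add: rev_conj_rev_conj assms(3))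
  next
    assume "f dvd rev_conj p"
    then have *: "rev_conj f dvd rev_conj (rev_conj p)" by (auto simp: dvd_def rev_conj_mult)
    \<comment> \<open>Reversing twice strips from \<open>p\<close> its power of x, which still
      leaves a divisor of \<open>p\<close>.\<close>
    have "rev_conj (rev_conj p) dvd p"
    proof (cases "p = 0")
      case False
      then obtain k q where q: "p = monom 1 k * q" "coeff q 0 \<noteq> 0"
        using order_decomp[OF False, of 0] by (auto simp: monom_altdef dvd_iff_poly_eq_0 poly_0_coeff_0)
      have "rev_conj (monom 1 k) = 1"
        by (auto simp: rev_conj_def poly_eq_iff coeff_reflect_poly degree_monom_eq)
      then have "rev_conj (rev_conj p) = q" by (simp add: q rev_conj_mult rev_conj_rev_conj)
      then show ?thesis by (simp add: q(1))
    qed (simp add: rev_conj_def)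
    with * show "rev_conj f dvd p" by (rule dvd_trans)
  qed
  finally show ?thesis by (simp add: p_def)
qed

text \<open>Orthogonality to the code is the vanishing of one coefficient for every
  \<open>y\<close>. By \<open>dvd_iff_coeffs_vanish\<close> this says that \<open>f\<close> divides
  the reversed conjugate of the word, and undoing the reversal moves the condition to
  \<open>dagger f\<close>.\<close>

lemma hermitian_dual_dvd:
  assumes N: "0 < N" and fg: "f * g = monom 1 N - 1"
  shows "hermitian_dual r N {v \<in> carrier_vec N. g dvd poly_of_word v}
    = {v \<in> carrier_vec N. dagger f dvd poly_of_word v}"
proof -
  \<comment> \<open>The constant terms of \<open>f\<close> and \<open>g\<close> multiply to
    -1.\<close>
  have f0: "coeff f 0 \<noteq> 0"
    using arg_cong[OF fg, of "\<lambda>p. coeff p 0"] N by (auto simp: coeff_mult_0)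
  have "(\<forall>y\<in>carrier_vec N. g dvd poly_of_word y \<longrightarrow> hermitian_inner r c y = 0)
      \<longleftrightarrow> dagger f dvd poly_of_word c" if c: "c \<in> carrier_vec N" for c
  proof -
    let ?R = "poly_of_word (vec N (\<lambda>i. conj (c $ (N - 1 - i))))"
    have "hermitian_inner r c y = 0 \<longleftrightarrow> coeff (?R * poly_of_word y) (N - 1) = 0"
      if "y \<in> carrier_vec N" for y
      using hermitian_inner_eq_coeff[OF N c that] by (metis hom_0_iff)
    then have "(\<forall>y\<in>carrier_vec N. g dvd poly_of_word y \<longrightarrow> hermitian_inner r c y = 0) \<longleftrightarrow> f dvd ?R"
      using dvd_iff_coeffs_vanish[OF N fg, of ?R] degree_poly_of_word[of "vec N (\<lambda>i. conj (c $ (N - 1 - i)))"] N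
      by auto
    then show ?thesis using dvd_reversed_word_iff[OF N c f0] by (simp add: dagger_dvd_iff)
  qed
  then show ?thesis by (auto simp: hermitian_dual_def)
qed

lemma dagger_mult: "dagger (f * g) = dagger f * dagger g"
  by (simp add: dagger_def rev_conj_mult normalize_mult)

lemma rev_conj_normalize: "normalize (rev_conj (normalize f)) = normalize (rev_conj f)"
  by (intro associatedI rev_conj_dvd) auto

lemma dagger_dagger: "coeff f 0 \<noteq> 0 \<Longrightarrow> dagger (dagger f) = normalize f"
  by (simp add: dagger_def rev_conj_normalize rev_conj_rev_conj)

lemma normalize_monic: "lead_coeff p = 1 \<Longrightarrow> normalize p = (p :: 'a poly)"
  by (simp add: normalize_poly_old_def)

lemma lead_coeff_normalize: "p \<noteq> 0 \<Longrightarrow> lead_coeff (normalize (p :: 'a poly)) = 1"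
  by (simp add: normalize_poly_old_def is_unit_unit_factor dvd_field_iff)

lemma degree_normalize: "degree (normalize (p :: 'a poly)) = degree p"
  by (cases "p = 0") (simp_all add: normalize_poly_old_def is_unit_unit_factor dvd_field_iff)

text \<open>Reversing x^N - 1 gives 1 - x^N, and normalizing absorbs the sign.\<close>

lemma dagger_monom_minus_1:
  assumes "0 < N"
  shows "dagger (monom 1 N - 1) = monom 1 N - 1"
proof -
  have "rev_conj (monom 1 N - 1) = - (monom 1 N - 1)"
    using assms by (auto simp: rev_conj_def poly_eq_iff coeff_reflect_poly hom_distribs)
  then have "dagger (monom 1 N - 1) = normalize (- (monom 1 N - 1))"
    by (simp only: dagger_def)
  also have "\<dots> = normalize (monom 1 N - 1)"
    by (rule associatedI) (simp_all only: minus_dvd_iff dvd_minus_iff dvd_refl)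
  also have "\<dots> = monom 1 N - 1"
    by (rule normalize_monic[OF lead_coeff_monom_minus_1[OF assms]])
  finally show ?thesis .
qed

lemma dagger_dvd_monom_minus_1:
  assumes "0 < N" "f dvd monom 1 N - 1"
  shows "dagger f dvd monom 1 N - 1"
  using assms by (metis dagger_monom_minus_1 dagger_mult dvd_def)

end

subsection \<open>The BCH bound\<close>

text \<open>
  If $S$ were too small, the relations would also annihilate the multiples of $x^b$ by polynomials of
  degree below $s$, such as the one vanishing at all $X_i$ except one.
\<close>

lemma bch_bound:
  fixes X c :: "'i \<Rightarrow> 'b::field"
  assumes "finite S" "S \<noteq> {}" "inj_on X S"
    and X: "\<And>i. i \<in> S \<Longrightarrow> X i \<noteq> 0" and c: "\<And>i. i \<in> S \<Longrightarrow> c i \<noteq> 0"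
    and vanish: "\<And>k. b \<le> k \<Longrightarrow> k < b + s \<Longrightarrow> (\<Sum>i\<in>S. c i * X i ^ k) = 0"
  shows "s < card S"
proof (rule ccontr)
  assume "\<not> s < card S"
  then have le: "card S \<le> s" by simp
  obtain i0 where i0: "i0 \<in> S" using assms(2) by blast
  define p where "p = (\<Prod>i\<in>S - {i0}. [:- X i, 1:])"
  have deg: "degree p = card S - 1"
    unfolding p_def using assms(1) i0 by (simp add: degree_prod_sum_eq)
  have pos: "0 < card S" using assms(1,2) by (simp add: card_gt_0_iff)
  have "(\<Sum>i\<in>S. c i * X i ^ b * poly p (X i)) = (\<Sum>i\<in>S. \<Sum>k\<le>degree p. coeff p k * (c i * X i ^ (b + k)))"
    by (simp add: poly_altdef sum_distrib_left power_add mult_ac)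
  also have "\<dots> = (\<Sum>k\<le>degree p. coeff p k * (\<Sum>i\<in>S. c i * X i ^ (b + k)))"
    by (subst sum.swap) (simp add: sum_distrib_left)
  also have "\<dots> = 0"
    using deg le pos by (intro sum.neutral) (auto intro!: vanish)
  also have "(\<Sum>i\<in>S. c i * X i ^ b * poly p (X i)) = c i0 * X i0 ^ b * poly p (X i0)"
  proof -
    have "poly p (X i) = 0" if "i \<in> S - {i0}" for i
      using that assms(1) by (auto simp: p_def poly_prod prod_zero_iff)
    then show ?thesis by (simp add: sum.remove[OF assms(1) i0])
  qed
  finally have "poly p (X i0) = 0" using X[OF i0] c[OF i0] by simp
  then show False
    using assms(1) i0 inj_onD[OF assms(3)] by (auto simp: p_def poly_prod prod_zero_iff)
qed

subsection \<open>Finite fields and minimal polynomials\<close>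

text \<open>Multiplication by a nonzero \<open>x\<close> permutes the nonzero elements, so comparing
  their products gives \<open>x ^ (CARD('a) - 1) = 1\<close>.\<close>

lemma finite_field_power_card:
  fixes x :: "'a::{field,finite}"
  shows "x ^ CARD('a) = x"
proof (cases "x = 0")
  case False
  have "(\<Prod>y\<in>UNIV - {0}. x * y) = \<Prod>(UNIV - {0})"
    by (rule prod.reindex_bij_witness[of _ "\<lambda>y. y / x" "\<lambda>y. x * y"]) (use False in auto)
  then have "x ^ card (UNIV - {0 :: 'a}) = 1"
    by (simp add: prod.distrib)
  then have "x * x ^ (CARD('a) - 1) = x" by (simp add: card_Diff_singleton)
  then show ?thesis
    using finite_UNIV_card_ge_0[where 'a = 'a] by (simp flip: power_Suc)
qed simp

text \<open>Translation by 1 permutes the field; comparing the sums of all elements shows that the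
  number of elements is zero in the field.\<close>

lemma CHAR_finite_field:
  assumes "CARD('a::{field,finite}) = p ^ k" "prime p"
  shows "CHAR('a) = p"
proof -
  have "prime CHAR('a)"
    using prime_CHAR_semidom[where 'a = 'a] finite_imp_CHAR_pos[where 'a = 'a] by simp
  moreover have "CHAR('a) dvd p"
  proof -
    have "(\<Sum>x\<in>UNIV. x + 1) = (\<Sum>x\<in>UNIV. x :: 'a)"
      by (rule sum.reindex_bij_witness[of _ "\<lambda>x. x - 1" "\<lambda>x. x + 1"]) auto
    then have "of_nat CARD('a) = (0 :: 'a)" by (simp add: sum.distrib)
    then have "CHAR('a) dvd p ^ k" by (simp only: of_nat_eq_0_iff_char_dvd assms(1))
    then show ?thesis using \<open>prime CHAR('a)\<close> prime_dvd_power by blast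
  qed
  ultimately show ?thesis using assms(2) by (simp add: primes_dvd_imp_eq)
qed

context field_hom begin

sublocale map_poly_hom: map_poly_inj_idom_hom hom ..

text \<open>\<open>p0\<close> witnesses that \<open>\<gamma>\<close> is algebraic, so a minimal
  polynomial exists. Division with remainder shows that it divides every annihilating polynomial and
  is therefore unique.\<close>

lemma poly_hom_minimal_poly:
  assumes "p0 \<noteq> 0" "poly (map_poly hom p0) \<gamma> = 0"
  shows "poly (map_poly hom p) \<gamma> = 0 \<longleftrightarrow> minimal_poly hom \<gamma> dvd p"
proof -
  define A where "A = {p. p \<noteq> 0 \<and> poly (map_poly hom p) \<gamma> = 0}"
  have "p0 \<in> A" using assms by (simp add: A_def)
  then obtain p1 where p1: "p1 \<in> A" "\<And>p. p \<in> A \<Longrightarrow> degree p1 \<le> degree p"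
    using ex_has_least_nat[of "\<lambda>p. p \<in> A" p0 degree] by blast
  define \<mu> where "\<mu> = Polynomial.smult (inverse (lead_coeff p1)) p1"
  have \<mu>: "is_minimal_poly hom \<gamma> \<mu>"
    using p1 by (auto simp: is_minimal_poly_def \<mu>_def A_def hom_distribs)
  have dvd: "\<nu> dvd p" if "is_minimal_poly hom \<gamma> \<nu>" "poly (map_poly hom p) \<gamma> = 0" for \<nu> p
  proof -
    have \<nu>: "\<nu> \<noteq> 0" "poly (map_poly hom \<nu>) \<gamma> = 0"
      "\<And>r. r \<noteq> 0 \<Longrightarrow> poly (map_poly hom r) \<gamma> = 0 \<Longrightarrow> degree \<nu> \<le> degree r"
      using that(1) by (auto simp: is_minimal_poly_def)
    have "p mod \<nu> = p - p div \<nu> * \<nu>" by (simp add: minus_div_mult_eq_mod)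
    then have "poly (map_poly hom (p mod \<nu>)) \<gamma> = 0"
      using that(2) \<nu>(2) by (simp add: hom_distribs)
    then have "p mod \<nu> = 0"
      using \<nu>(3)[of "p mod \<nu>"] degree_mod_less'[OF \<nu>(1), of p] by linarith
    then show ?thesis by (simp add: mod_eq_0_iff_dvd)
  qed
  have "minimal_poly hom \<gamma> = \<mu>"
    unfolding minimal_poly_def
  proof (rule the_equality)
    show "\<nu> = \<mu>" if "is_minimal_poly hom \<gamma> \<nu>" for \<nu>
      using that \<mu> dvd by (intro poly_dvd_antisym) (auto simp: is_minimal_poly_def)
  qed (fact \<mu>)
  then show ?thesis
    using \<mu> dvd[OF \<mu>] by (auto simp: is_minimal_poly_def hom_distribs elim!: dvdE)
qed

end

subsection \<open>Exponents modulo $r^{2m} - 1$\<close>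

text \<open>
  For $e > m$ multiply by $r^{2m-e}$, which reduces to a number between $0$ and $r^{2m} - 1$ as for
  $e < m$; here oddness of $m$ and $e$ improves $e < m$ to $e \le m - 2$. For $e = m$ the quotient can
  only be $1$, which forces $r^m$ to divide $i + 1$.
\<close>

lemma odd_exponent_not_dvd:
  fixes r m e i k :: nat
  assumes "2 \<le> r" "odd m" "odd e" "e < 2 * m" "3 \<le> r ^ m"
    and "1 \<le> i" "i + 2 \<le> r ^ m" "k + 2 \<le> 2 * r ^ m"
  shows "\<not> r ^ (2 * m) - 1 dvd i + k * r ^ e"
proof
  define Q where "Q = r ^ m"
  have QQ: "r ^ (2 * m) = Q * Q" by (simp add: Q_def mult_2 power_add)
  assume dvd: "r ^ (2 * m) - 1 dvd i + k * r ^ e"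
  have Q: "3 \<le> Q" "i + 2 \<le> Q" "k + 2 \<le> 2 * Q" using assms by (simp_all add: Q_def)
  \<comment> \<open>The factor 4 is the lower bound for \<open>r ^ 2\<close>; in the case e < m it
    outweighs the factor 2 in the bound on \<open>k\<close>.\<close>
  have small: "4 * r ^ f \<le> Q" if "odd f" "f < m" for f
  proof -
    have "f + 2 \<le> m" using that assms(2) by presburger
    then have "r ^ (f + 2) \<le> Q" unfolding Q_def using assms(1) by (intro power_increasing) auto
    moreover have "r ^ f * 4 \<le> r ^ f * r ^ 2"
      using power_mono[OF assms(1), of 2] by (intro mult_left_mono) auto
    ultimately show ?thesis unfolding power_add by linarith
  qed
  consider "e < m" | "e = m" | "m < e" by linarith
  then show False
  proof cases
    case 1
    have "k * (4 * r ^ e) \<le> k * Q" using small[OF assms(3) 1] by (rule mult_le_mono2)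
    moreover have "k * Q + 2 * Q \<le> 2 * (Q * Q)" using mult_le_mono1[OF Q(3), of Q] by (simp add: algebra_simps)
    moreover have "3 * Q \<le> Q * Q" using Q(1) by (rule mult_le_mono1)
    ultimately have "i + k * r ^ e < Q * Q - 1" using Q by linarith
    then show False using dvd assms(6) by (auto dest!: dvd_imp_le simp: QQ)
  next
    case 2
    obtain w where w: "i + k * Q = (Q * Q - 1) * w" using dvd by (auto simp: QQ 2 Q_def elim!: dvdE)
    have "k * Q + 2 * Q \<le> 2 * (Q * Q)" using mult_le_mono1[OF Q(3), of Q] by (simp add: algebra_simps)
    then have "i + k * Q < (Q * Q - 1) * 2" using Q by linarith
    then have "w < 2" unfolding w by (simp only: mult_less_cancel1)
    moreover have "w \<noteq> 0" using w assms(6) by (metis add_is_0 mult_0_right not_one_le_zero)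
    ultimately have "w = 1" by simp
    then have "(i + 1) + k * Q = Q * Q" using w Q by simp
    then have "Q dvd i + 1" by (metis dvd_add_left_iff dvd_triv_right)
    then show False using Q by (auto dest!: dvd_imp_le)
  next
    case 3
    define t where "t = r ^ (2 * m - e)"
    have "odd (2 * m - e)" "2 * m - e < m" using assms(3,4) 3 by auto
    then have t: "4 * t \<le> Q" unfolding t_def by (rule small)
    have "r ^ e * t = Q * Q"
      unfolding t_def QQ[symmetric] power_add[symmetric] using assms(4) by simp
    then have "(i + k * r ^ e) * t = i * t + k * (Q * Q)" by (simp add: algebra_simps)
    also have "k * (Q * Q) = k + k * (Q * Q - 1)"
      using Q by (simp add: diff_mult_distrib2)
    also have "i * t + \<dots> = (i * t + k) + k * (Q * Q - 1)" by simp
    finally have "Q * Q - 1 dvd (i * t + k) + k * (Q * Q - 1)"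
      using dvd by (metis QQ dvd_mult2)
    then have "Q * Q - 1 dvd i * t + k" by (simp add: dvd_add_left_iff)
    moreover have "0 < i * t + k" using assms(1,6) by (simp add: t_def)
    ultimately have "Q * Q - 1 \<le> i * t + k" by (rule dvd_imp_le)
    moreover have "i * (4 * t) \<le> i * Q" using t by (rule mult_le_mono2)
    moreover have "i * Q + 2 * Q \<le> Q * Q" using mult_le_mono1[OF Q(2), of Q] by (simp add: algebra_simps)
    moreover have "3 * Q \<le> Q * Q" using Q(1) by (rule mult_le_mono1)
    ultimately show False using Q by linarith
  qed
qed

text \<open>Excludes that the conjugated inverse of \<beta>^k is a root of the BCH generator.
  Multiplying by r^(2m - 2j), an inverse of r^(2j) modulo r^(2m) - 1, leaves one odd power of
  \<open>r\<close> beside \<open>k\<close>; for j = 0 the exponent is already 1.\<close>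

lemma cyclotomic_not_dvd:
  fixes r m i j k :: nat
  assumes "2 \<le> r" "odd m" "j < m" "3 \<le> r ^ m"
    and "1 \<le> i" "i + 2 \<le> r ^ m" "k + 2 \<le> 2 * r ^ m"
  shows "\<not> r ^ (2 * m) - 1 dvd i * r ^ (2 * j) + k * r"
proof
  assume dvd: "r ^ (2 * m) - 1 dvd i * r ^ (2 * j) + k * r"
  show False
  proof (cases "j = 0")
    case True
    then show False
      using dvd odd_exponent_not_dvd[of r m 1 i k] assms by (auto elim: oddE)
  next
    case False
    define t where "t = r ^ (2 * m - 2 * j)"
    have e: "r ^ (2 * j) * t = r ^ (2 * m)" "r * t = r ^ (2 * m - 2 * j + 1)"
      unfolding t_def using assms(3) by (simp_all flip: power_add)
    have "1 \<le> r ^ (2 * m)" using assms(1) by simp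
    then have *: "i * r ^ (2 * m) = i + i * (r ^ (2 * m) - 1)"
      by (simp add: diff_mult_distrib2)
    have "(i * r ^ (2 * j) + k * r) * t = i * (r ^ (2 * j) * t) + k * (r * t)"
      by (simp only: algebra_simps)
    also have "\<dots> = (i + k * r ^ (2 * m - 2 * j + 1)) + i * (r ^ (2 * m) - 1)"
      unfolding e * by simp
    finally have "(i * r ^ (2 * j) + k * r) * t = (i + k * r ^ (2 * m - 2 * j + 1)) + i * (r ^ (2 * m) - 1)" .
    then have "r ^ (2 * m) - 1 dvd (i + k * r ^ (2 * m - 2 * j + 1)) + i * (r ^ (2 * m) - 1)"
      using dvd by (metis dvd_mult2)
    then have "r ^ (2 * m) - 1 dvd i + k * r ^ (2 * m - 2 * j + 1)"
      by (simp only: dvd_add_left_iff dvd_triv_right)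
    moreover have "odd (2 * m - 2 * j + 1)" "2 * m - 2 * j + 1 < 2 * m"
      using False assms(3) by auto
    ultimately show False using odd_exponent_not_dvd assms by blast
  qed
qed

subsection \<open>The code and its Hermitian dual\<close>

text \<open>The assumption \<open>three_le\<close> is the condition \<delta> \<ge> 2.\<close>

locale hermitian_bch = field_hom h
  for h :: "'a::{field_gcd,finite} \<Rightarrow> 'b::{field,finite}" +
  fixes r s m :: nat and \<beta> :: 'b
  assumes s: "1 \<le> s" and r: "r = 2 ^ s" and odd_m: "odd m"
    and card_a: "CARD('a) = r ^ 2" and card_b: "CARD('b) = r ^ (2 * m)"
    and primitive: "primitive_root_of_unity (r ^ (2 * m) - 1) \<beta>"
    and three_le: "3 \<le> r ^ m"
begin

definition n :: nat where "n = r ^ (2 * m) - 1"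
definition Q :: nat where "Q = r ^ m"
definition \<delta> :: nat where "\<delta> = Q - 1"
definition g :: "'a poly" where "g = Lcm ((\<lambda>i. minimal_poly h (\<beta> ^ i)) ` {1..<\<delta>})"

lemma two_le_r: "2 \<le> r"
  using power_increasing[OF s, of "2 :: nat"] by (simp add: r)

lemma m_pos: "0 < m"
  using odd_m by (cases m) auto

lemma QQ: "r ^ (2 * m) = Q * Q"
  by (simp add: Q_def mult_2 power_add)

lemma n_eq: "n = \<delta> * (Q + 1)"
  unfolding n_def QQ \<delta>_def by (cases Q) auto

lemma Q_ge: "3 \<le> Q" and \<delta>_ge: "2 \<le> \<delta>"
  using three_le by (simp_all add: Q_def \<delta>_def)

lemma n_pos: "0 < n"
  using Q_ge \<delta>_ge by (simp add: n_eq)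

lemma odd_n: "odd n"
proof -
  have "even (r ^ (2 * m))" using s m_pos by (simp add: r)
  moreover have "1 \<le> r ^ (2 * m)" using two_le_r by simp
  ultimately show ?thesis unfolding n_def by presburger
qed

lemma CHAR_a: "CHAR('a) = 2" and CHAR_b: "CHAR('b) = 2"
  using CHAR_finite_field[where 'a = 'a, of 2 "s * 2"] CHAR_finite_field[where 'a = 'b, of 2 "s * (2 * m)"]
    card_a card_b by (simp_all add: r power_mult)

lemma two_eq_0: "(2 :: 'a) = 0" "(2 :: 'b) = 0"
  using of_nat_CHAR[where 'a = 'a] of_nat_CHAR[where 'a = 'b] by (simp_all add: CHAR_a CHAR_b)

lemma of_nat_char_2: "of_nat i = (of_bool (odd i) :: 'b)"
proof (cases "odd i")
  case True
  then obtain k where "i = 2 * k + 1" by (elim oddE)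
  then show ?thesis by (simp add: two_eq_0)
qed (auto simp: two_eq_0)

lemma power_card_a: "(x :: 'a) ^ (r ^ 2) = x"
  using finite_field_power_card[of x] by (simp add: card_a)

lemma power_card_b: "(x :: 'b) ^ (r ^ (2 * m)) = x"
  using finite_field_power_card[of x] by (simp add: card_b)

lemma frobenius_add_a: "((x :: 'a) + y) ^ (2 ^ k) = x ^ (2 ^ k) + y ^ (2 ^ k)"
  by (rule freshmans_dream') (simp_all add: CHAR_a)

lemma frobenius_add_b: "((x :: 'b) + y) ^ (2 ^ k) = x ^ (2 ^ k) + y ^ (2 ^ k)"
  by (rule freshmans_dream') (simp_all add: CHAR_b)

sublocale conj: conjugation "\<lambda>x :: 'a. x ^ r" r
proof unfold_locales
  show "(x ^ r) ^ r = x" for x :: 'a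
    using power_card_a[of x] by (simp add: power2_eq_square power_mult)
qed (simp_all add: r frobenius_add_a power_mult_distrib)

sublocale frob_b: field_hom "\<lambda>x :: 'b. x ^ (2 ^ k)" for k
  by unfold_locales (simp_all add: frobenius_add_b power_mult_distrib)

abbreviation ev :: "'a poly \<Rightarrow> 'b \<Rightarrow> 'b" where
  "ev p x \<equiv> poly (map_poly h p) x"

lemma \<beta>_pow_n: "\<beta> ^ n = 1" and \<beta>_neq_0: "\<beta> \<noteq> 0"
  using primitive n_pos by (auto simp: primitive_root_of_unity_def n_def power_0_left)

lemma \<beta>_pow_eq_1_iff: "\<beta> ^ k = 1 \<longleftrightarrow> n dvd k"
proof
  assume *: "\<beta> ^ k = 1"
  have "\<beta> ^ k = (\<beta> ^ n) ^ (k div n) * \<beta> ^ (k mod n)"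
    by (simp flip: power_mult power_add)
  then have "\<beta> ^ (k mod n) = 1" by (simp add: * \<beta>_pow_n)
  then have "k mod n = 0"
    using primitive mod_less_divisor[OF n_pos, of k]
    unfolding n_def[symmetric] primitive_root_of_unity_def by auto
  then show "n dvd k" by auto
qed (auto simp: power_mult \<beta>_pow_n)

lemma \<beta>_pow_inj: "\<beta> ^ i = \<beta> ^ j \<longleftrightarrow> i mod n = j mod n"
proof (induction i j rule: linorder_wlog)
  case (le i j)
  then have "\<beta> ^ j = \<beta> ^ i * \<beta> ^ (j - i)" by (simp flip: power_add)
  then have "\<beta> ^ i = \<beta> ^ j \<longleftrightarrow> n dvd j - i" using \<beta>_neq_0 by (simp flip: \<beta>_pow_eq_1_iff)
  then show ?case using mod_eq_dvd_iff_nat[OF le, of n] by auto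
qed auto

lemma ev_dvd: "p dvd p' \<Longrightarrow> ev p x = 0 \<Longrightarrow> ev p' x = 0"
  by (elim dvdE) (simp add: hom_distribs)

lemma ev_monom_minus_1: "ev (monom 1 k - 1) x = x ^ k - 1"
  by (simp add: hom_distribs poly_monom)

text \<open>x^n - 1 witnesses that \<beta>^i is algebraic over the base field.\<close>

lemma minimal_poly_dvd_iff: "minimal_poly h (\<beta> ^ i) dvd p \<longleftrightarrow> ev p (\<beta> ^ i) = 0"
  using poly_hom_minimal_poly[of "monom 1 n - 1" "\<beta> ^ i" p] monom_minus_1_neq_0[OF n_pos, where 'a = 'a]
  by (simp add: ev_monom_minus_1 flip: power_mult) (metis mult.commute power_mult \<beta>_pow_n power_one diff_self)

lemma g_dvd_iff: "g dvd p \<longleftrightarrow> (\<forall>i\<in>{1..<\<delta>}. ev p (\<beta> ^ i) = 0)"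
  by (simp add: g_def Lcm_dvd_iff minimal_poly_dvd_iff)

lemma \<beta>_pow_pow_n: "(\<beta> ^ i) ^ n = 1"
  by (metis \<beta>_pow_n mult.commute power_mult power_one)

lemma g_dvd: "g dvd monom 1 n - 1"
  by (simp add: g_dvd_iff ev_monom_minus_1 \<beta>_pow_pow_n)

lemma lead_coeff_g: "lead_coeff g = 1"
proof -
  have "g \<noteq> 0" using g_dvd monom_minus_1_neq_0[OF n_pos, where 'a = 'a] by auto
  moreover have "normalize g = g" by (simp add: g_def)
  ultimately show ?thesis
    using conj.lead_coeff_normalize[of g] by simp
qed

text \<open>The polynomial x^(r^2) - x has at most r^2 roots, and the image of the base field
  already supplies that many.\<close>

lemma fixed_by_frobenius_in_range:
  assumes "(x :: 'b) ^ (r ^ 2) = x"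
  shows "x \<in> range h"
proof -
  define p :: "'b poly" where "p = monom 1 (r ^ 2) - monom 1 1"
  have "1 < r ^ 2" using two_le_r by (intro one_less_power) auto
  then have "coeff p (r ^ 2) = 1" by (simp add: p_def)
  then have p: "p \<noteq> 0" by auto
  have "degree p \<le> r ^ 2"
    unfolding p_def using \<open>1 < r ^ 2\<close> by (intro degree_diff_le) (auto simp: degree_monom_eq)
  then have "card {x. poly p x = 0} \<le> r ^ 2"
    using card_poly_roots_bound[OF p] by simp
  moreover have "range h \<subseteq> {x. poly p x = 0}"
    by (auto simp: p_def poly_monom power_card_a simp flip: hom_power)
  moreover have "card (range h) = r ^ 2"
    using card_image[of h UNIV] card_a by (simp add: inj_on_def)
  ultimately have "range h = {x. poly p x = 0}"
    using poly_roots_finite[OF p] by (intro card_seteq) auto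
  with assms show ?thesis by (auto simp: p_def poly_monom)
qed

text \<open>
  The product of $x - \gamma^{r^{2j}}$ over $j < m$ is fixed by the Frobenius map, so it has
  coefficients in the base field and the minimal polynomial divides it.
\<close>

lemma root_minimal_poly:
  assumes "ev (minimal_poly h (\<beta> ^ i)) x = 0"
  shows "\<exists>j<m. x = \<beta> ^ (i * r ^ (2 * j))"
proof -
  define \<gamma> where "\<gamma> = \<beta> ^ i"
  define P where "P = (\<Prod>j<m. [:- (\<gamma> ^ (r ^ (2 * j))), 1:])"
  have r2: "r ^ 2 = 2 ^ (s * 2)" by (simp add: r power_mult)
  interpret F: field_hom "\<lambda>x :: 'b. x ^ (r ^ 2)" unfolding r2 by (rule frob_b.field_hom_axioms)
  have step: "(\<gamma> ^ (r ^ (2 * j))) ^ (r ^ 2) = \<gamma> ^ (r ^ (2 * Suc j))" for j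
    by (simp flip: power_mult power_add)
  have "map_poly (\<lambda>x. x ^ (r ^ 2)) P = (\<Prod>j<m. [:- (\<gamma> ^ (r ^ (2 * Suc j))), 1:])"
    unfolding P_def by (simp add: F.map_poly_hom.hom_prod F.map_poly_pCons_hom F.hom_uminus step del: mult_Suc_right)
  \<comment> \<open>The Frobenius map shifts the factors cyclically, because \<gamma>^(r^(2m)) =
    \<gamma>.\<close>
  also have "\<dots> = P"
  proof -
    obtain m' where m': "m = Suc m'" using m_pos by (cases m) auto
    have "(\<Prod>j<m. [:- (\<gamma> ^ (r ^ (2 * Suc j))), 1:]) = (\<Prod>j<m'. [:- (\<gamma> ^ (r ^ (2 * Suc j))), 1:]) * [:- (\<gamma> ^ (r ^ (2 * m))), 1:]"
      unfolding m' by simp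
    also have "\<gamma> ^ (r ^ (2 * m)) = \<gamma> ^ (r ^ (2 * 0))" by (simp add: power_card_b)
    finally show ?thesis unfolding P_def m' prod.lessThan_Suc_shift by (simp add: mult.commute)
  qed
  finally have fixed: "map_poly (\<lambda>x. x ^ (r ^ 2)) P = P" .
  have "coeff P k \<in> range h" for k
  proof (rule fixed_by_frobenius_in_range)
    show "coeff P k ^ (r ^ 2) = coeff P k"
      using arg_cong[OF fixed, of "\<lambda>p. coeff p k"] by simp
  qed
  \<comment> \<open>The coefficients are pulled back through \<open>h\<close>; its inverse sends 0
    to 0, so \<open>map_poly\<close> acts coefficientwise.\<close>
  then have "map_poly h (map_poly (inv_into UNIV h) P) = P"
    by (intro poly_eqI) (simp add: coeff_map_poly f_inv_into_f inv_f_eq[OF inj_f hom_zero])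
  then obtain p where p: "map_poly h p = P" by blast
  have "poly P \<gamma> = 0"
    unfolding P_def poly_prod using m_pos by (auto simp: prod_zero_iff intro!: bexI[of _ 0])
  then have "minimal_poly h \<gamma> dvd p" by (simp add: \<gamma>_def minimal_poly_dvd_iff p)
  then have "ev p x = 0" using assms unfolding \<gamma>_def by (rule ev_dvd)
  then have "poly P x = 0" by (simp add: p)
  then show ?thesis
    by (auto simp: P_def poly_prod prod_zero_iff \<gamma>_def simp flip: power_mult)
qed

text \<open>The least common multiple divides the product, so a root of \<open>g\<close> is a
  conjugate of one of the prescribed powers of \<beta>.\<close>

lemma root_g:
  assumes "ev g x = 0"
  shows "\<exists>i\<in>{1..<\<delta>}. \<exists>j<m. x = \<beta> ^ (i * r ^ (2 * j))"
proof -
  let ?M = "\<Prod>i\<in>{1..<\<delta>}. minimal_poly h (\<beta> ^ i)"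
  have "g dvd ?M"
    by (auto simp: g_def Lcm_dvd_iff)
  then have "ev ?M x = 0" using assms by (rule ev_dvd)
  then obtain i where "i \<in> {1..<\<delta>}" "ev (minimal_poly h (\<beta> ^ i)) x = 0"
    by (auto simp: hom_distribs poly_prod prod_zero_iff)
  then show ?thesis using root_minimal_poly by blast
qed

section \<open>Zeros of the generator polynomial of the Hermitian dual\<close>

definition f :: "'a poly" where "f = (monom 1 n - 1) div g"
definition gH :: "'a poly" where "gH = conj.dagger f"

lemma f_mult_g: "f * g = monom 1 n - 1"
  using g_dvd by (simp add: f_def)

text \<open>x \<mapsto> x^r is a homomorphism of the extension field too, and on the coefficients,
  which come from the base field, it undoes the conjugation.\<close>

lemma ev_conj: "ev (map_poly (\<lambda>x. x ^ r) p) x ^ r = ev p (x ^ r)"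
proof -
  interpret F: field_hom "\<lambda>x :: 'b. x ^ r" unfolding r by (rule frob_b.field_hom_axioms)
  have "map_poly (\<lambda>x. x ^ r) (map_poly h (map_poly (\<lambda>x. x ^ r) p)) = map_poly h p"
    by (rule poly_eqI) (simp add: conj.conj_conj flip: hom_power)
  then show ?thesis by (metis F.poly_map_poly)
qed

text \<open>Up to reversal and conjugation, the claim is that the r-th power of \<beta>^(-k) is a
  root of \<open>f\<close>. It is a root of f g = x^n - 1, so it suffices that it is no root of
  \<open>g\<close>; \<open>root_g\<close> turns such a root into the divisibility excluded by
  \<open>cyclotomic_not_dvd\<close>.\<close>

lemma ev_gH: "k + 2 \<le> 2 * Q \<Longrightarrow> ev gH (\<beta> ^ k) = 0"
proof -
  assume k: "k + 2 \<le> 2 * Q"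
  define z where "z = inverse (\<beta> ^ k)"
  have z: "z \<noteq> 0" "z ^ n = 1" by (simp_all add: z_def \<beta>_neq_0 \<beta>_pow_pow_n power_inverse)
  have zr: "(z ^ r) ^ n = 1" by (metis mult.commute power_mult power_one z(2))
  have "ev (f * g) (z ^ r) = 0" by (simp add: f_mult_g ev_monom_minus_1 zr)
  moreover have "ev g (z ^ r) \<noteq> 0"
  proof
    assume "ev g (z ^ r) = 0"
    then obtain i j where ij: "1 \<le> i" "i < \<delta>" "j < m" "z ^ r = \<beta> ^ (i * r ^ (2 * j))"
      using root_g by fastforce
    have "\<beta> ^ (i * r ^ (2 * j) + k * r) = (z * \<beta> ^ k) ^ r"
      by (simp add: power_add ij(4) power_mult_distrib flip: power_mult)
    also have "\<dots> = 1" by (simp add: z_def \<beta>_neq_0)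
    finally have "n dvd i * r ^ (2 * j) + k * r" by (simp add: \<beta>_pow_eq_1_iff)
    then show False
      using cyclotomic_not_dvd[OF two_le_r odd_m ij(3) three_le, of i k] ij(1,2) k
      unfolding n_def \<delta>_def Q_def by linarith
  qed
  ultimately have "ev f (z ^ r) = 0" by (simp add: hom_distribs)
  then have "ev (map_poly (\<lambda>x. x ^ r) f) z = 0" using ev_conj[of f z] two_le_r by simp
  then have "poly (reflect_poly (map_poly h (map_poly (\<lambda>x. x ^ r) f))) (inverse z) = 0"
    using z(1) by (simp add: poly_reflect_poly_nz)
  moreover have "map_poly h (reflect_poly p) = reflect_poly (map_poly h p)" for p
    by (rule poly_eqI) (simp add: coeff_reflect_poly)
  ultimately have "ev (conj.rev_conj f) (\<beta> ^ k) = 0"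
    by (simp add: conj.rev_conj_def z_def)
  moreover have "conj.rev_conj f dvd gH" by (simp add: gH_def flip: conj.dagger_dvd_iff)
  ultimately show ?thesis using ev_dvd by blast
qed

lemma degree_f_g: "degree f + degree g = n"
proof -
  have "f \<noteq> 0" "g \<noteq> 0" using f_mult_g monom_minus_1_neq_0[OF n_pos, where 'a = 'a] by auto
  then show ?thesis using degree_mult_eq[of f g] by (simp add: f_mult_g)
qed

lemma coeff_0_neq_0: "coeff f 0 \<noteq> 0" "coeff g 0 \<noteq> 0"
  using arg_cong[OF f_mult_g, of "\<lambda>p. coeff p 0"] n_pos by (auto simp: coeff_mult_0)

lemma gH_dvd: "gH dvd monom 1 n - 1"
  unfolding gH_def by (rule conj.dagger_dvd_monom_minus_1[OF n_pos]) (metis f_mult_g dvd_triv_left)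

lemma lead_coeff_gH: "lead_coeff gH = 1"
proof -
  have "conj.rev_conj f \<noteq> 0"
    using coeff_0_neq_0(1) by (auto simp: conj.rev_conj_def)
  then show ?thesis unfolding gH_def conj.dagger_def by (rule conj.lead_coeff_normalize)
qed

lemma degree_gH: "degree gH = degree f"
  using coeff_0_neq_0(1)
  by (simp add: gH_def conj.dagger_def conj.degree_rev_conj conj.degree_normalize)

lemma degree_g_gH: "degree (g * gH) = n"
proof -
  have "g \<noteq> 0" "gH \<noteq> 0" using lead_coeff_g lead_coeff_gH by auto
  then show ?thesis using degree_f_g by (simp add: degree_mult_eq degree_gH)
qed

section \<open>Self-duality in characteristic 2\<close>

lemma monom_2n: "monom 1 (2 * n) - 1 = (monom 1 n - 1) * (monom 1 n - (1 :: 'a poly))"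
proof -
  have "(2 :: 'a poly) = 0" using two_eq_0(1) by (simp add: numeral_poly)
  then have "monom 1 n + monom 1 n = (0 :: 'a poly)" by (metis mult_2 mult_zero_left)
  moreover have "(1 :: 'a poly) + 1 = 0" using \<open>2 = 0\<close> by simp
  ultimately show ?thesis
    by (simp add: algebra_simps mult_monom flip: mult_2)
qed

lemma g_gH_dvd: "g * gH dvd monom 1 (2 * n) - 1"
  unfolding monom_2n by (intro mult_dvd_mono g_dvd gH_dvd)

lemma self_dual:
  "hermitian_dual r (2 * n) {v \<in> carrier_vec (2 * n). g * gH dvd poly_of_word v}
    = {v \<in> carrier_vec (2 * n). g * gH dvd poly_of_word v}"
proof -
  have 1: "gH * conj.dagger g = monom 1 n - 1"
    unfolding gH_def conj.dagger_mult[symmetric] f_mult_g by (rule conj.dagger_monom_minus_1[OF n_pos])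
  have "(f * conj.dagger g) * (g * gH) = (f * g) * (gH * conj.dagger g)"
    by (simp only: mult_ac)
  then have 2: "(f * conj.dagger g) * (g * gH) = monom 1 (2 * n) - 1"
    by (simp only: f_mult_g 1 monom_2n)
  have "conj.dagger (f * conj.dagger g) = gH * normalize g"
    by (simp add: conj.dagger_mult gH_def conj.dagger_dagger coeff_0_neq_0)
  then have 3: "conj.dagger (f * conj.dagger g) = g * gH"
    by (simp add: conj.normalize_monic lead_coeff_g mult.commute)
  show ?thesis
    using conj.hermitian_dual_dvd[OF _ 2] n_pos by (simp add: 3)
qed

subsection \<open>Minimum distance\<close>

lemma ev_poly_of_word: "ev (poly_of_word v) x = (\<Sum>i<dim_vec v. h (v $ i) * x ^ i)"
  by (simp add: poly_of_word_def hom_distribs poly_sum poly_monom)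

text \<open>In characteristic 2 the factor \<open>i\<close> from differentiation is the parity of
  \<open>i\<close>; multiplying by \<open>x\<close> restores the exponents.\<close>

lemma pderiv_poly_of_word:
  "x * ev (pderiv (poly_of_word v)) x = (\<Sum>i | i < dim_vec v \<and> odd i. h (v $ i) * x ^ i)"
proof -
  have "x * ev (pderiv (poly_of_word v)) x = (\<Sum>i<dim_vec v. of_nat i * (h (v $ i) * (x * x ^ (i - 1))))"
    by (simp add: poly_of_word_def hom_distribs poly_sum poly_monom pderiv_sum pderiv_monom
        sum_distrib_left mult_ac)
  \<comment> \<open>For i = 0, where the exponent \<open>i - 1\<close> truncates, the factor is
    zero.\<close>
  also have "\<dots> = (\<Sum>i<dim_vec v. of_bool (odd i) * (h (v $ i) * x ^ i))"
    unfolding of_nat_char_2 by (intro sum.cong) (auto elim!: oddE)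
  also have "\<dots> = (\<Sum>i | i < dim_vec v \<and> odd i. h (v $ i) * x ^ i)"
    by (rule sum.mono_neutral_cong_right) auto
  finally show ?thesis .
qed

lemma weight_ge:
  assumes c: "c \<in> carrier_vec (2 * n)" "g * gH dvd poly_of_word c" "c \<noteq> 0\<^sub>v (2 * n)"
  shows "2 * \<delta> \<le> card {i. i < 2 * n \<and> c $ i \<noteq> 0}"
proof -
  let ?supp = "{i. i < 2 * n \<and> c $ i \<noteq> 0}"
  have dim [simp]: "dim_vec c = 2 * n" using c(1) by simp
  \<comment> \<open>\<open>d\<close> is the word folded modulo x^n - 1: evaluation at n-th roots of
    unity does not separate \<open>j\<close> from \<open>j + n\<close>.\<close>
  define d where "d j = h (c $ j) + h (c $ (j + n))" for j
  show ?thesis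
  proof (cases "\<exists>j<n. d j \<noteq> 0")
    case True
    define S where "S = {j. j < n \<and> d j \<noteq> 0}"
    \<comment> \<open>The exponents 0 to 2Q - 2 from \<open>ev_gH\<close> give 2Q - 1 consecutive
      relations.\<close>
    have "2 * Q - 1 < card S"
    proof (rule bch_bound[where b = 0 and X = "\<lambda>j. \<beta> ^ j" and c = d])
      show "inj_on (\<lambda>j. \<beta> ^ j) S" by (auto simp: inj_on_def \<beta>_pow_inj S_def)
      show "(\<Sum>j\<in>S. d j * (\<beta> ^ j) ^ k) = 0" if "k < 0 + (2 * Q - 1)" for k
      proof -
        have power_commute: "(\<beta> ^ k) ^ j = (\<beta> ^ j) ^ k" for j
          by (metis mult.commute power_mult)
        have per: "(\<beta> ^ k) ^ (j + n) = (\<beta> ^ k) ^ j" for j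
          by (simp add: power_add \<beta>_pow_pow_n)
        have "0 = ev (poly_of_word c) (\<beta> ^ k)"
          using ev_dvd[OF dvd_mult_right[OF c(2)] ev_gH[of k]] that by simp
        also have "\<dots> = (\<Sum>i<2 * n. h (c $ i) * (\<beta> ^ k) ^ i)" by (simp add: ev_poly_of_word)
        also have "\<dots> = (\<Sum>i<n. h (c $ i) * (\<beta> ^ k) ^ i) + (\<Sum>i=n..<n+n. h (c $ i) * (\<beta> ^ k) ^ i)"
          unfolding mult_2 lessThan_atLeast0 by (rule sum.atLeastLessThan_concat[symmetric]) auto
        also have "(\<Sum>i=n..<n+n. h (c $ i) * (\<beta> ^ k) ^ i) = (\<Sum>j<n. h (c $ (j + n)) * (\<beta> ^ k) ^ (j + n))"
          using sum.shift_bounds_nat_ivl[of "\<lambda>i. h (c $ i) * (\<beta> ^ k) ^ i" 0 n n]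
          by (simp add: lessThan_atLeast0)
        also have "(\<Sum>i<n. h (c $ i) * (\<beta> ^ k) ^ i) + \<dots> = (\<Sum>j<n. d j * (\<beta> ^ j) ^ k)"
          unfolding sum.distrib[symmetric] d_def per distrib_right by (simp only: power_commute)
        also have "\<dots> = (\<Sum>j\<in>S. d j * (\<beta> ^ j) ^ k)"
          by (rule sum.mono_neutral_right) (auto simp: S_def)
        finally show ?thesis by simp
      qed
    qed (use True in \<open>auto simp: S_def \<beta>_neq_0\<close>)
    \<comment> \<open>A nonzero folded entry needs a nonzero entry at \<open>j\<close> or
      \<open>j + n\<close>, so folding does not increase the weight.\<close>
    moreover have "S \<subseteq> (\<lambda>i. i mod n) ` ?supp"
    proof
      fix j assume j: "j \<in> S"
      then have "c $ j \<noteq> 0 \<or> c $ (j + n) \<noteq> 0" by (auto simp: S_def d_def)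
      then show "j \<in> (\<lambda>i. i mod n) ` ?supp"
        using j by (auto simp: S_def intro: image_eqI[of _ _ j] image_eqI[of _ _ "j + n"])
    qed
    then have "card S \<le> card ?supp" by (rule surj_card_le[rotated]) auto
    ultimately show ?thesis by (simp add: \<delta>_def)
  next
    case False
    \<comment> \<open>Now all \<open>d j\<close> vanish, so entries at positions differing by
      \<open>n\<close> modulo 2n are both zero or both nonzero.\<close>
    have swap: "c $ ((i + n) mod (2 * n)) \<noteq> 0 \<longleftrightarrow> c $ i \<noteq> 0" if "i < 2 * n" for i
    proof -
      have eq: "c $ j \<noteq> 0 \<longleftrightarrow> c $ (j + n) \<noteq> 0" if "j < n" for j
        using False that by (auto simp: d_def)
      show ?thesis
      proof (cases "i < n")
        case False
        then have "(i + n) mod (2 * n) = i - n" using that by (simp add: mod_if)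
        then show ?thesis using eq[of "i - n"] False that by simp
      qed (use eq in simp)
    qed
    \<comment> \<open>Since \<open>n\<close> is odd and 2n is even, the shift exchanges even and odd
      positions.\<close>
    have parity: "odd ((i + n) mod (2 * n)) \<longleftrightarrow> even i" for i
      using odd_n by (simp add: dvd_mod_iff)
    define S where "S = {i. i < 2 * n \<and> odd i \<and> c $ i \<noteq> 0}"
    define S' where "S' = {i. i < 2 * n \<and> even i \<and> c $ i \<noteq> 0}"
    have inj: "inj_on (\<lambda>i. (i + n) mod (2 * n)) {..<2 * n}"
    proof (rule inj_onI)
      fix i j assume "i \<in> {..<2 * n}" "j \<in> {..<2 * n}" "(i + n) mod (2 * n) = (j + n) mod (2 * n)"
      then show "i = j" by (auto simp: mod_if split: if_splits)
    qed
    have "(\<lambda>i. (i + n) mod (2 * n)) ` S \<subseteq> S'"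
      using n_pos swap parity by (auto simp: S_def S'_def)
    then have le: "card S \<le> card S'"
      by (intro card_inj_on_le[OF inj_on_subset[OF inj]]) (auto simp: S_def S'_def)
    have "S \<noteq> {}"
    proof -
      obtain i where i: "i < 2 * n" "c $ i \<noteq> 0" using c(1,3) by (metis eq_vecI carrier_vecD dim index_zero_vec)
      then have "i \<in> S \<or> (i + n) mod (2 * n) \<in> S"
        using swap parity n_pos by (auto simp: S_def)
      then show ?thesis by auto
    qed
    have "\<delta> - 1 < card S"
    proof (rule bch_bound[where b = 1 and X = "\<lambda>i. \<beta> ^ i" and c = "\<lambda>i. h (c $ i)"])
      \<comment> \<open>\<beta> has order \<open>n\<close> although positions run up to 2n - 1. The
        powers are distinct on \<open>S\<close> because \<open>i\<close> and \<open>i + n\<close>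
        have opposite parity.\<close>
      show "inj_on (\<lambda>i. \<beta> ^ i) S"
      proof (rule inj_onI)
        fix i j assume ij: "i \<in> S" "j \<in> S" "\<beta> ^ i = \<beta> ^ j"
        then have "i mod n = j mod n" by (simp add: \<beta>_pow_inj)
        moreover have "i < 2 * n" "j < 2 * n" "odd i" "odd j" using ij by (auto simp: S_def)
        ultimately have "i = j \<or> i = j + n \<or> j = i + n"
          by (auto simp: mod_if split: if_splits)
        then show "i = j" using \<open>odd i\<close> \<open>odd j\<close> odd_n by auto
      qed
      show "(\<Sum>i\<in>S. h (c $ i) * (\<beta> ^ i) ^ k) = 0" if "1 \<le> k" "k < 1 + (\<delta> - 1)" for k
      proof -
        obtain a where a: "poly_of_word c = g * gH * a" using c(2) by blast
        have "ev g (\<beta> ^ k) = 0" using g_dvd_iff[of g] that by simp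
        moreover have "ev gH (\<beta> ^ k) = 0" using that by (intro ev_gH) (simp add: \<delta>_def)
        \<comment> \<open>By the product rule every summand keeps a factor \<open>g\<close> or
          \<open>gH\<close>, and both vanish at \<beta>^k.\<close>
        ultimately have "ev (pderiv (poly_of_word c)) (\<beta> ^ k) = 0"
          by (simp add: a pderiv_mult hom_distribs)
        then have "0 = (\<Sum>i | i < 2 * n \<and> odd i. h (c $ i) * (\<beta> ^ k) ^ i)"
          using pderiv_poly_of_word[of "\<beta> ^ k" c] by simp
        also have "\<dots> = (\<Sum>i\<in>S. h (c $ i) * (\<beta> ^ k) ^ i)"
          by (rule sum.mono_neutral_right) (auto simp: S_def)
        also have "\<dots> = (\<Sum>i\<in>S. h (c $ i) * (\<beta> ^ i) ^ k)"
          by (simp add: mult.commute flip: power_mult)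
        finally show ?thesis by simp
      qed
    qed (use \<open>S \<noteq> {}\<close> in \<open>auto simp: S_def \<beta>_neq_0\<close>)
    moreover have "card ?supp = card S + card S'"
      by (subst card_Un_disjoint[symmetric]) (auto simp: S_def S'_def intro!: arg_cong[of _ _ card])
    ultimately show ?thesis using le by simp
  qed
qed

text \<open>The coefficients of (x^(2n) - 1)/(x^(Q + 1) - 1), a geometric sum with 2n/(Q + 1) =
  2\<delta> terms.\<close>

definition w :: "'a vec" where "w = vec (2 * n) (\<lambda>i. of_bool (Q + 1 dvd i))"

lemma w_mult: "(monom 1 (Q + 1) - 1) * poly_of_word w = monom 1 (2 * n) - 1"
  unfolding w_def by (rule monom_minus_1_mult_comb) (simp_all only: n_eq dvd_triv_right zero_less_Suc Suc_eq_plus1[symmetric] flip: mult.assoc)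

text \<open>By \<open>monom_2n\<close> the polynomial of \<open>w\<close> is U (x^n - 1) with U =
  (x^n - 1)/(x^(Q + 1) - 1). The second factor absorbs \<open>gH\<close>, and \<open>g\<close>
  divides U because no \<beta>^i with 1 \<le> i < \<delta> is a (Q + 1)-th root of unity.\<close>

lemma g_gH_dvd_w: "g * gH dvd poly_of_word w"
proof -
  have "Q + 1 dvd n" by (simp only: n_eq dvd_triv_right)
  define U :: "'a poly" where "U = poly_of_word (vec n (\<lambda>i. of_bool (Q + 1 dvd i)))"
  have U: "monom 1 n - 1 = (monom 1 (Q + 1) - 1) * U"
    unfolding U_def by (rule monom_minus_1_mult_comb[symmetric]) (use \<open>Q + 1 dvd n\<close> in auto)
  have "g dvd U"
    unfolding g_dvd_iff
  proof
    fix i assume i: "i \<in> {1..<\<delta>}"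
    have "\<not> n dvd i * (Q + 1)"
    proof
      assume "n dvd i * (Q + 1)"
      then have "\<delta> * (Q + 1) \<le> i * (Q + 1)" unfolding n_eq using i by (intro dvd_imp_le) auto
      then have "\<delta> \<le> i" by (simp only: mult_le_cancel2)
      with i show False by simp
    qed
    then have "\<beta> ^ (i * (Q + 1)) \<noteq> 1" by (simp only: \<beta>_pow_eq_1_iff not_False_eq_True)
    then have "ev (monom 1 (Q + 1) - 1) (\<beta> ^ i) \<noteq> 0"
      unfolding ev_monom_minus_1 power_mult by simp
    moreover have "ev (monom 1 n - 1) (\<beta> ^ i) = 0" by (simp add: ev_monom_minus_1 \<beta>_pow_pow_n)
    ultimately show "ev U (\<beta> ^ i) = 0" unfolding U by (simp add: hom_distribs)
  qed
  then have "g * gH dvd U * (monom 1 n - 1)" by (intro mult_dvd_mono gH_dvd)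
  moreover have "(monom 1 (Q + 1) - 1) * poly_of_word w = (monom 1 (Q + 1) - 1) * (U * (monom 1 n - 1))"
    unfolding w_mult monom_2n mult.assoc[symmetric] U[symmetric] ..
  then have "poly_of_word w = U * (monom 1 n - 1)"
    using monom_minus_1_neq_0[of "Q + 1", where 'a = 'a] by simp
  ultimately show ?thesis by simp
qed

lemma weight_w: "card {i. i < 2 * n \<and> w $ i \<noteq> 0} = 2 * \<delta>"
proof -
  have "{i. i < 2 * n \<and> w $ i \<noteq> 0} = (\<lambda>j. (Q + 1) * j) ` {..<2 * \<delta>}"
  proof (intro equalityI subsetI)
    fix i assume "i \<in> {i. i < 2 * n \<and> w $ i \<noteq> 0}"
    then have i: "i < 2 * n" "Q + 1 dvd i" by (auto simp: w_def split: if_splits)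
    then obtain j where j: "i = (Q + 1) * j" by blast
    have "(Q + 1) * j < (Q + 1) * (2 * \<delta>)" using i(1) by (simp add: j n_eq algebra_simps)
    then have "j < 2 * \<delta>" by (simp only: mult_less_cancel1)
    then show "i \<in> (\<lambda>j. (Q + 1) * j) ` {..<2 * \<delta>}" using j by blast
  next
    fix i assume "i \<in> (\<lambda>j. (Q + 1) * j) ` {..<2 * \<delta>}"
    then obtain j where j: "j < 2 * \<delta>" "i = (Q + 1) * j" by blast
    then have "i < (Q + 1) * (2 * \<delta>)" by (simp only: mult_less_cancel1) simp
    then have "i < 2 * n" by (simp add: n_eq algebra_simps)
    moreover have "Q + 1 dvd i" unfolding j(2) by (rule dvd_triv_left)
    ultimately show "i \<in> {i. i < 2 * n \<and> w $ i \<noteq> 0}" by (simp add: w_def)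
  qed
  moreover have "inj_on (\<lambda>j. (Q + 1) * j) {..<2 * \<delta>}"
    by (rule inj_onI) (simp only: mult_cancel1, simp)
  ultimately show ?thesis using card_image by fastforce
qed

text \<open>Differences of codewords are codewords, so distances reduce to weights; \<open>w\<close>
  and the zero word attain the bound.\<close>

lemma min_distance: "is_min_distance {v \<in> carrier_vec (2 * n). g * gH dvd poly_of_word v} (2 * \<delta>)"
proof -
  let ?D = "{v \<in> carrier_vec (2 * n). g * gH dvd poly_of_word v}"
  have "w \<noteq> 0\<^sub>v (2 * n)"
  proof
    assume "w = 0\<^sub>v (2 * n)"
    then have "{i. i < 2 * n \<and> w $ i \<noteq> 0} = {}" by auto
    then have "0 = 2 * \<delta>" using weight_w by (metis card.empty)
    then show False using \<delta>_ge by simp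
  qed
  moreover have "w \<in> ?D" "0\<^sub>v (2 * n) \<in> ?D" using g_gH_dvd_w by (simp_all add: w_def)
  moreover have "hamming_dist w (0\<^sub>v (2 * n)) = 2 * \<delta>"
    unfolding hamming_dist_def weight_w[symmetric]
    by (rule arg_cong[of _ _ card]) (auto simp: w_def)
  moreover have "2 * \<delta> \<le> hamming_dist x y" if xy: "x \<in> ?D" "y \<in> ?D" "x \<noteq> y" for x y
  proof -
    have dims: "dim_vec x = 2 * n" "dim_vec y = 2 * n" using xy by auto
    then have "poly_of_word (x - y) = poly_of_word x - poly_of_word y"
      by (intro poly_eqI) (simp add: coeff_poly_of_word)
    moreover have "x - y \<noteq> 0\<^sub>v (2 * n)"
    proof
      assume *: "x - y = 0\<^sub>v (2 * n)"
      have "x = y"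
      proof (rule eq_vecI)
        fix i assume "i < dim_vec y"
        then show "x $ i = y $ i" using dims arg_cong[OF *, of "\<lambda>v. v $ i"] by simp
      qed (use dims in simp)
      with xy show False by simp
    qed
    ultimately have "2 * \<delta> \<le> card {i. i < 2 * n \<and> (x - y) $ i \<noteq> 0}"
      using xy by (intro weight_ge) auto
    also have "{i. i < 2 * n \<and> (x - y) $ i \<noteq> 0} = {i. i < dim_vec x \<and> x $ i \<noteq> y $ i}"
      using dims by auto
    finally show ?thesis by (simp add: hamming_dist_def)
  qed
  ultimately show ?thesis unfolding is_min_distance_def by blast
qed

text \<open>With b = 1 the last exponent b + \<delta> - 2 is \<delta> - 1, so the integer range is
  the image of \<open>{1..<\<delta>}\<close>.\<close>

lemma bch_code_eq: "bch_code h n \<delta> 1 \<beta> = code_generated_by n g"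
proof -
  have "(\<lambda>i. minimal_poly h (\<beta> powi i)) ` {1..1 + int \<delta> - 2} = (\<lambda>i. minimal_poly h (\<beta> ^ i)) ` {1..<\<delta>}"
  proof -
    have "{1..1 + int \<delta> - 2} = int ` {1..<\<delta>}"
      using \<delta>_ge by (simp add: image_int_atLeastLessThan) auto
    then show ?thesis by (simp only: image_image power_int_of_nat)
  qed
  then show ?thesis by (simp only: bch_code_def g_def)
qed

theorem hermitian_bch_self_dual:
  defines "C' \<equiv> code_generated_by (2 * n) (g * gH)"
  shows "generator_poly n (bch_code h n \<delta> 1 \<beta>) = g"
    and "generator_poly n (hermitian_dual r n (bch_code h n \<delta> 1 \<beta>)) = gH"
    and "is_generator_poly (2 * n) C' (g * gH)" "hermitian_self_dual r (2 * n) C'"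
    and "has_parameters C' (2 * n) n (2 * \<delta>)"
proof -
  show "generator_poly n (bch_code h n \<delta> 1 \<beta>) = g"
    unfolding bch_code_eq by (rule generator_poly_code_generated_by[OF n_pos g_dvd lead_coeff_g])
  have "hermitian_dual r n (bch_code h n \<delta> 1 \<beta>) = {v \<in> carrier_vec n. gH dvd poly_of_word v}"
    unfolding bch_code_eq code_generated_by_eq[OF g_dvd] gH_def
    by (rule conj.hermitian_dual_dvd[OF n_pos f_mult_g])
  also have "\<dots> = code_generated_by n gH"
    by (rule code_generated_by_eq[OF gH_dvd, symmetric])
  finally have "hermitian_dual r n (bch_code h n \<delta> 1 \<beta>) = code_generated_by n gH" .
  then show "generator_poly n (hermitian_dual r n (bch_code h n \<delta> 1 \<beta>)) = gH"
    by (simp add: generator_poly_code_generated_by[OF n_pos gH_dvd lead_coeff_gH])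
  have N: "0 < 2 * n" using n_pos by simp
  have C': "C' = {v \<in> carrier_vec (2 * n). g * gH dvd poly_of_word v}"
    unfolding C'_def by (rule code_generated_by_eq[OF g_gH_dvd])
  have monic: "lead_coeff (g * gH) = 1"
    by (simp add: lead_coeff_mult lead_coeff_g lead_coeff_gH)
  show "is_generator_poly (2 * n) C' (g * gH)"
    unfolding C'_def by (rule is_generator_poly_code_generated_by[OF N g_gH_dvd monic])
  show "hermitian_self_dual r (2 * n) C'"
    unfolding hermitian_self_dual_def C' self_dual ..
  have "code_dim (2 * n) C' = 2 * n - degree (g * gH)"
    unfolding C' using monic by (intro code_dim_dvd[OF N]) (auto simp: degree_g_gH)
  then show "has_parameters C' (2 * n) n (2 * \<delta>)"
    unfolding has_parameters_def using linear_code_dvd[of "2 * n" "g * gH"] min_distance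
    by (simp add: degree_g_gH C')
qed

end

theorem theorem12:
  fixes h :: "'a::{field_gcd,finite} \<Rightarrow> 'b::{field,finite}"
    and \<beta> :: 'b
    and q\<^sub>1 q m n \<delta> :: nat
    and C :: "'a vec set" and g gH :: "'a poly" and C' :: "'a vec set"
  assumes "\<exists>s\<ge>1. q\<^sub>1 = 2 ^ s"
    and "q = q\<^sub>1 ^ 2"
    and "odd m"
    and "CARD('a) = q"
    and "CARD('b) = q ^ m"
    and "field_hom h"
    and "n = q ^ m - 1"
    and "primitive_root_of_unity n \<beta>"
    and "\<delta> = q\<^sub>1 ^ m - 1"
    and "\<delta> \<ge> 2"
    and "C = bch_code h n \<delta> 1 \<beta>"
    and "g = generator_poly n C"
    and "gH = generator_poly n (hermitian_dual q\<^sub>1 n C)"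
    and "C' = code_generated_by (2 * n) (g * gH)"
  shows "is_generator_poly (2 * n) C' (g * gH) \<and>
         cyclic_code (2 * n) C' \<and>
         hermitian_self_dual q\<^sub>1 (2 * n) C' \<and>
         has_parameters C' (2 * (q ^ m - 1)) (q ^ m - 1) (2 * (q\<^sub>1 ^ m - 1))"
proof -
  obtain s where s: "1 \<le> s" "q\<^sub>1 = 2 ^ s" using assms(1) by blast
  have qm: "q ^ m = q\<^sub>1 ^ (2 * m)" using assms(2) by (simp add: power_mult)
  interpret field_hom h by (fact assms(6))
  interpret B: hermitian_bch h q\<^sub>1 s m \<beta>
    by unfold_locales (use assms s qm in auto)
  have n: "n = B.n" and \<delta>: "\<delta> = B.\<delta>"
    using assms(7,9) by (simp_all add: qm B.n_def B.\<delta>_def B.Q_def)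
  have g: "g = B.g" and gH: "gH = B.gH"
    using assms(11-13) B.hermitian_bch_self_dual(1,2) by (simp_all add: n \<delta>)
  have "is_generator_poly (2 * n) C' (g * gH)" "hermitian_self_dual q\<^sub>1 (2 * n) C'"
    "has_parameters C' (2 * n) n (2 * \<delta>)"
    using B.hermitian_bch_self_dual(3-5) assms(14) by (simp_all add: n \<delta> g gH)
  then show ?thesis
    using assms(7,9) by (simp add: is_generator_poly_def)
qed

end
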